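(* There is a constant $K>0$ such that for all $\kappa,d>0$ with $\kappa d>K$ there is exactly one $c=c_1>0$ such that $I(c_1)=0$ (and, by symmetry, exactly one negative $c$ with $I(c)=0$). Further, $h(c_1)>h(0)$.
   Context: Let $\kappa,d>0$. For each $c\in\mathbb R$ there is a unique $h=h(c)>0$ such that the linear problem $$\psi_0''=\kappa^2\bigl(h^2(x+c)^2-1\bigr)\psi_0\ \text{ on }[-d,d],\qquad \psi_0(-d)=1,\quad \psi_0'(\pm d)=0$$ has a positive solution $\psi_0$, and this positive solution is unique (this is standard linear theory). With this $h(c)$ and $\psi_0=\psi_0(\cdot\,;c)$ define $$I(c)=\int_{-d}^{d}(x+c)\,\psi_0(x)^2\,dx .$$ Both $h(c)$ and $I(c)$ depend on $\kappa$ and $d$. *)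

theory Defs
  imports "HOL-Analysis.Analysis"
begin

text \<open>
  The function \<open>\<phi>\<close> is the derivative of \<open>\<psi>\<close>. At the end points
  \<open>-d\<close> and \<open>d\<close> the derivatives are one-sided. Nothing is said about the
  values of \<open>\<psi>\<close> outside \<open>{-d..d}\<close>.
\<close>

definition pos_solution ::
  "real \<Rightarrow> real \<Rightarrow> real \<Rightarrow> real \<Rightarrow> (real \<Rightarrow> real) \<Rightarrow> bool" where
  "pos_solution \<kappa> d c h \<psi> \<longleftrightarrow>
     (\<exists>\<phi>. (\<forall>x\<in>{-d..d}. (\<psi> has_real_derivative \<phi> x) (at x within {-d..d})) \<and>
          (\<forall>x\<in>{-d..d}. (\<phi> has_real_derivative \<kappa>\<^sup>2 * (h\<^sup>2 * (x + c)\<^sup>2 - 1) * \<psi> x)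
                          (at x within {-d..d})) \<and>
          \<phi> (-d) = 0 \<and> \<phi> d = 0) \<and>
     \<psi> (-d) = 1 \<and>
     (\<forall>x\<in>{-d..d}. \<psi> x > 0)"

definition h_field :: "real \<Rightarrow> real \<Rightarrow> real \<Rightarrow> real" where
  "h_field \<kappa> d c = (THE h. h > 0 \<and> (\<exists>\<psi>. pos_solution \<kappa> d c h \<psi>))"

text \<open>
  A solution is determined only on \<open>{-d..d}\<close>; extending it by \<open>0\<close> makes it
  unique as a function on all reals.
\<close>

definition psi0 :: "real \<Rightarrow> real \<Rightarrow> real \<Rightarrow> real \<Rightarrow> real" where
  "psi0 \<kappa> d c = (THE \<psi>. pos_solution \<kappa> d c (h_field \<kappa> d c) \<psi> \<and>
                          (\<forall>x. x \<notin> {-d..d} \<longrightarrow> \<psi> x = 0))"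

definition I_fun :: "real \<Rightarrow> real \<Rightarrow> real \<Rightarrow> real" where
  "I_fun \<kappa> d c = integral {-d..d} (\<lambda>x. (x + c) * (psi0 \<kappa> d c x)\<^sup>2)"

end

theory Submission
  imports Defs
begin

text \<open>
  After scaling by \<open>\<kappa>\<close> the problem is \<open>u'' = (g\<^sup>2 y\<^sup>2 - 1) u\<close> with Neumann conditions on \<open>[C - D, C + D]\<close>, where
  \<open>g = h / \<kappa>\<close>, \<open>C = \<kappa> c\<close>, \<open>D = \<kappa> d\<close>. For \<open>g \<ge> 1\<close> let \<open>E\<close>, \<open>O\<close> be the even and odd solutions and \<open>\<eta> = -E'/O'\<close>.
  Constancy of the Wronskian gives \<open>\<eta>' = -\<gamma>\<close> with \<open>\<gamma>(y) = (g\<^sup>2 y\<^sup>2 - 1) / O'(y)\<^sup>2\<close>. A positive Neumann solution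
  on \<open>[-s, b]\<close> exists iff \<open>\<eta>(s) + \<eta>(b) = 0\<close>, and, the integrand of \<open>I\<close> being exact, \<open>I = 0\<close> iff
  \<open>\<gamma>(s) = \<gamma>(b)\<close>. So \<open>I(c) = 0\<close> says that \<open>\<Phi>\<^sub>g(C) = \<eta>(D - C) + \<eta>(D + C)\<close> vanishes together with its
  derivative in \<open>C\<close>. As \<open>\<gamma>\<close> decreases on \<open>[2, \<infinity>)\<close> and is tiny at \<open>D + C\<close> for large \<open>D\<close>, a critical point
  \<open>C > 0\<close> forces \<open>D - C\<close> to be close to \<open>1/g\<close>, where \<open>\<gamma>\<close> increases; hence it is the strict maximum of
  \<open>\<Phi>\<^sub>g\<close> on \<open>[0, D]\<close>. Since \<open>\<Phi>\<^sub>g\<close> decreases in \<open>g\<close>, every zero of \<open>I\<close> on \<open>c > 0\<close> is the strict maximum of \<open>h\<close> on \<open>[0, d)\<close>.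
  This yields uniqueness and \<open>h(c\<^sub>1) > h(0)\<close>; existence follows by taking the largest \<open>g\<close> for which \<open>\<Phi>\<^sub>g\<close> has a
  nonnegative value.
\<close>

section \<open>Solutions as power series\<close>

text \<open>Taylor coefficients at \<open>0\<close> of the solution of
  \<open>u'' = (g\<^sup>2 y\<^sup>2 - 1) u\<close> with value \<open>A\<close> and slope
  \<open>B\<close> at \<open>0\<close>. The recurrence reaches back four indices, so the
  coefficients of index 2 and 3, to which \<open>g\<close> does not yet contribute, are listed
  separately.\<close>

fun osc_coeff :: "real \<Rightarrow> real \<Rightarrow> real \<Rightarrow> nat \<Rightarrow> real" where
  "osc_coeff g A B 0 = A"
| "osc_coeff g A B (Suc 0) = B"
| "osc_coeff g A B (Suc (Suc 0)) = - A / 2"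
| "osc_coeff g A B (Suc (Suc (Suc 0))) = - B / 6"
| "osc_coeff g A B (Suc (Suc (Suc (Suc n)))) =
     (g\<^sup>2 * osc_coeff g A B n - osc_coeff g A B (Suc (Suc n))) / ((real n + 4) * (real n + 3))"

definition osc :: "real \<Rightarrow> real \<Rightarrow> real \<Rightarrow> real \<Rightarrow> real" where
  "osc g A B y = (\<Sum>n. osc_coeff g A B n * y ^ n)"

definition osc' :: "real \<Rightarrow> real \<Rightarrow> real \<Rightarrow> real \<Rightarrow> real" where
  "osc' g A B y = (\<Sum>n. diffs (osc_coeff g A B) n * y ^ n)"

text \<open>The recurrence divides by a quadratic in the index. From index \<open>N + 4\<close> on,
  it therefore cannot raise a bound on the terms weighted with \<open>\<rho> ^ n\<close>, and the
  sum of the earlier weighted terms bounds them all.\<close>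

lemma osc_coeff_bounded:
  fixes \<rho> :: real
  assumes "\<rho> > 0"
  shows "\<exists>M. \<forall>n. \<bar>osc_coeff g A B n\<bar> * \<rho> ^ n \<le> M"
proof -
  let ?c = "osc_coeff g A B"
  obtain N :: nat where N: "g\<^sup>2 * \<rho>^4 + \<rho>\<^sup>2 \<le> real N"
    using real_arch_simple by blast
  define M where "M = (\<Sum>n<N+4. \<bar>?c n\<bar> * \<rho> ^ n)"
  have "\<bar>?c n\<bar> * \<rho> ^ n \<le> M" for n
  proof (induction n rule: less_induct)
    case (less n)
    show ?case
    proof (cases "n < N + 4")
      case True
      then show ?thesis
        unfolding M_def using assms by (intro member_le_sum) auto
    next
      case False
      define m where "m = n - 4"
      have n: "n = Suc (Suc (Suc (Suc m)))" and m: "m \<ge> N"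
        using False by (auto simp: m_def)
      let ?d = "(real m + 4) * (real m + 3)"
      have d: "?d \<ge> g\<^sup>2 * \<rho>^4 + \<rho>\<^sup>2" "?d > 0"
      proof -
        have "g\<^sup>2 * \<rho>^4 + \<rho>\<^sup>2 \<le> real m"
          using N m by linarith
        also have "\<dots> \<le> ?d"
          by (simp add: algebra_simps)
        finally show "?d \<ge> g\<^sup>2 * \<rho>^4 + \<rho>\<^sup>2" .
      qed auto
      have M0: "M \<ge> 0"
        unfolding M_def using assms by (intro sum_nonneg) auto
      have a: "\<bar>?c m\<bar> * \<rho> ^ m \<le> M" "\<bar>?c (Suc (Suc m))\<bar> * \<rho> ^ (Suc (Suc m)) \<le> M"
        using less[of m] less[of "Suc (Suc m)"] n by auto
      have "\<bar>?c n\<bar> * \<rho> ^ n = \<bar>g\<^sup>2 * ?c m - ?c (Suc (Suc m))\<bar> * \<rho> ^ n / ?d"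
        by (simp add: n abs_divide)
      also have "\<dots> \<le> (g\<^sup>2 * \<bar>?c m\<bar> + \<bar>?c (Suc (Suc m))\<bar>) * \<rho> ^ n / ?d"
      proof (intro divide_right_mono mult_right_mono)
        show "\<bar>g\<^sup>2 * ?c m - ?c (Suc (Suc m))\<bar> \<le> g\<^sup>2 * \<bar>?c m\<bar> + \<bar>?c (Suc (Suc m))\<bar>"
          using abs_triangle_ineq4[of "g\<^sup>2 * ?c m" "?c (Suc (Suc m))"] by (simp add: abs_mult)
      qed (use assms in auto)
      also have "\<dots> = (g\<^sup>2 * \<rho>^4 * (\<bar>?c m\<bar> * \<rho> ^ m) + \<rho>\<^sup>2 * (\<bar>?c (Suc (Suc m))\<bar> * \<rho> ^ (Suc (Suc m)))) / ?d"
        by (simp add: n algebra_simps power2_eq_square power4_eq_xxxx)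
      also have "\<dots> \<le> (g\<^sup>2 * \<rho>^4 * M + \<rho>\<^sup>2 * M) / ?d"
        using a assms by (intro divide_right_mono add_mono mult_left_mono) auto
      also have "\<dots> = M * (g\<^sup>2 * \<rho>^4 + \<rho>\<^sup>2) / ?d"
        by (simp add: algebra_simps)
      also have "\<dots> \<le> M * ?d / ?d"
        using d M0 by (intro divide_right_mono mult_left_mono) auto
      finally show ?thesis
        using d by simp
    qed
  qed
  then show ?thesis by blast
qed

lemma osc_coeff_summable: "summable (\<lambda>n. osc_coeff g A B n * y ^ n)"
proof -
  \<comment> \<open>A radius of at least twice \<open>\<bar>y\<bar>\<close> gives a geometric
    majorant of ratio \<open>1/2\<close>; the added \<open>1\<close> keeps it positive for
    \<open>y = 0\<close>.\<close>
  define \<rho> where "\<rho> = 2 * \<bar>y\<bar> + 1"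
  have \<rho>: "\<rho> > 0" by (simp add: \<rho>_def add_nonneg_pos)
  obtain M where M: "\<And>n. \<bar>osc_coeff g A B n\<bar> * \<rho> ^ n \<le> M"
    using osc_coeff_bounded[OF \<rho>, of g A B] by blast
  show ?thesis
  proof (rule summable_comparison_test)
    show "summable (\<lambda>n. M * (1/2::real) ^ n)"
      by (intro summable_mult summable_geometric) auto
    have "norm (osc_coeff g A B n * y ^ n) \<le> M * (1/2) ^ n" for n
    proof -
      have "\<bar>y\<bar> \<le> \<rho> * (1/2)"
        by (simp add: \<rho>_def)
      then have "\<bar>y\<bar> ^ n \<le> \<rho> ^ n * (1/2) ^ n"
        using power_mono[of "\<bar>y\<bar>" "\<rho> * (1/2)" n] unfolding power_mult_distrib by simp
      then have "\<bar>osc_coeff g A B n\<bar> * \<bar>y\<bar> ^ n \<le> \<bar>osc_coeff g A B n\<bar> * (\<rho> ^ n * (1/2) ^ n)"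
        by (intro mult_left_mono) auto
      also have "\<dots> \<le> M * (1/2) ^ n"
        using mult_right_mono[OF M[of n], of "(1/2)^n"] by (simp add: mult.assoc)
      finally show ?thesis
        by (simp add: abs_mult power_abs)
    qed
    then show "\<exists>N. \<forall>n\<ge>N. norm (osc_coeff g A B n * y ^ n) \<le> M * (1/2) ^ n"
      by blast
  qed
qed

lemma osc_deriv [derivative_intros]:
  assumes "(f has_real_derivative f') (at y within S)"
  shows "((\<lambda>y. osc g A B (f y)) has_real_derivative osc' g A B (f y) * f') (at y within S)"
proof -
  have "(osc g A B has_real_derivative osc' g A B z) (at z)" for z
    unfolding osc_def [abs_def] osc'_def
    by (rule termdiffs_strong_converges_everywhere) (rule osc_coeff_summable)
  from DERIV_chain2[OF this assms] show ?thesis .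
qed

lemma osc'_deriv [derivative_intros]:
  assumes "(f has_real_derivative f') (at y within S)"
  shows "((\<lambda>y. osc' g A B (f y)) has_real_derivative
           (g\<^sup>2 * (f y)\<^sup>2 - 1) * osc g A B (f y) * f') (at y within S)"
proof -
  let ?c = "osc_coeff g A B"
  have "(osc' g A B has_real_derivative (\<Sum>n. diffs (diffs ?c) n * z ^ n)) (at z)" for z
    unfolding osc'_def [abs_def]
    by (rule termdiffs_strong_converges_everywhere, rule termdiff_converges_all,
        rule osc_coeff_summable)
  moreover have "(\<Sum>n. diffs (diffs ?c) n * z ^ n) = (g\<^sup>2 * z\<^sup>2 - 1) * osc g A B z" for z
  proof -
    have c: "(\<lambda>n. ?c n * z ^ n) sums osc g A B z"
      unfolding osc_def by (rule summable_sums[OF osc_coeff_summable])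
    \<comment> \<open>\<open>F\<close> collects the terms of \<open>u'' + u\<close>: the first two
      vanish, and the others are those of \<open>u\<close> multiplied by
      \<open>g\<^sup>2 * z\<^sup>2\<close>.\<close>
    define F where "F = (\<lambda>n. (diffs (diffs ?c) n + ?c n) * z ^ n)"
    have F2: "F (n + 2) = g\<^sup>2 * z\<^sup>2 * (?c n * z ^ n)" for n
    proof -
      have "diffs (diffs ?c) (n + 2) + ?c (n + 2) = g\<^sup>2 * ?c n"
      proof -
        have "diffs (diffs ?c) (n + 2) = ((real n + 4) * (real n + 3)) * ?c (Suc (Suc (Suc (Suc n))))"
          by (simp add: diffs_def algebra_simps del: osc_coeff.simps)
        also have "\<dots> = g\<^sup>2 * ?c n - ?c (Suc (Suc n))"
          by simp
        finally show ?thesis by simp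
      qed
      then show ?thesis
        unfolding F_def power_add by (simp only: mult_ac)
    qed
    have "(\<lambda>n. F (n + 2)) sums (g\<^sup>2 * z\<^sup>2 * osc g A B z)"
      unfolding F2 by (rule sums_mult[OF c])
    moreover have "(\<Sum>i<2. F i) = 0"
      by (simp add: F_def diffs_def numeral_2_eq_2)
    ultimately have "F sums (g\<^sup>2 * z\<^sup>2 * osc g A B z)"
      using sums_iff_shift[of F 2 "g\<^sup>2 * z\<^sup>2 * osc g A B z"] by simp
    from sums_diff[OF this c] show ?thesis
      by (simp add: F_def algebra_simps sums_iff)
  qed
  ultimately have "(osc' g A B has_real_derivative (g\<^sup>2 * z\<^sup>2 - 1) * osc g A B z) (at z)" for z
    by simp
  from DERIV_chain2[OF this assms] show ?thesis .
qed

lemma osc_0 [simp]: "osc g A B 0 = A"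
  by (simp add: osc_def)

lemma osc'_0 [simp]: "osc' g A B 0 = B"
  by (simp add: osc'_def diffs_def)

lemma continuous_on_osc [continuous_intros]:
  "continuous_on S f \<Longrightarrow> continuous_on S (\<lambda>y. osc g A B (f y))"
  using continuous_on_compose2[of UNIV "osc g A B" S f]
    DERIV_continuous_on[of UNIV "osc g A B", OF osc_deriv[OF DERIV_ident, unfolded mult_1_right]]
  by simp

lemma continuous_on_osc' [continuous_intros]:
  "continuous_on S f \<Longrightarrow> continuous_on S (\<lambda>y. osc' g A B (f y))"
  using continuous_on_compose2[of UNIV "osc' g A B" S f]
    DERIV_continuous_on[of UNIV "osc' g A B", OF osc'_deriv[OF DERIV_ident, unfolded mult_1_right]]
  by simp

text \<open>Gronwall: \<open>N = w\<^sup>2 + z\<^sup>2\<close> satisfies \<open>N' \<le> (M + 2) N + \<epsilon>\<^sup>2\<close>.\<close>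

lemma linear_ode_bound:
  fixes w z Q f :: "real \<Rightarrow> real"
  assumes w: "\<And>x. x \<in> {a..b} \<Longrightarrow> (w has_real_derivative z x) (at x within {a..b})"
    and z: "\<And>x. x \<in> {a..b} \<Longrightarrow> (z has_real_derivative Q x * w x + f x) (at x within {a..b})"
    and Q: "\<And>x. x \<in> {a..b} \<Longrightarrow> \<bar>Q x\<bar> \<le> M"
    and f: "\<And>x. x \<in> {a..b} \<Longrightarrow> \<bar>f x\<bar> \<le> \<epsilon>"
    and 0: "w a = 0" "z a = 0" and x: "x \<in> {a..b}"
  shows "\<bar>w x\<bar> \<le> \<epsilon> * exp ((M + 2) * (b - a))" "\<bar>z x\<bar> \<le> \<epsilon> * exp ((M + 2) * (b - a))"
proof -
  have a: "a \<in> {a..b}" using x by auto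
  have M: "M \<ge> 0" and e: "\<epsilon> \<ge> 0"
    using Q[OF a] f[OF a] by linarith+
  define N where "N = (\<lambda>t. ((w t)\<^sup>2 + (z t)\<^sup>2 + \<epsilon>\<^sup>2) * exp (- (M + 2) * (t - a)))"
  define N' where "N' = (\<lambda>t. (2 * w t * z t + 2 * z t * (Q t * w t + f t)
      - (M + 2) * ((w t)\<^sup>2 + (z t)\<^sup>2 + \<epsilon>\<^sup>2)) * exp (- (M + 2) * (t - a)))"
  have d: "(N has_real_derivative N' t) (at t within {a..b})" if "t \<in> {a..b}" for t
    unfolding N_def N'_def
    by (rule derivative_eq_intros w z that refl)+ (simp add: algebra_simps power2_eq_square)
  have N'0: "N' t \<le> 0" if t: "t \<in> {a..b}" for t
  proof -
    have 1: "2 * w t * z t \<le> (w t)\<^sup>2 + (z t)\<^sup>2"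
      using sum_squares_bound[of "w t" "z t"] by (simp add: power2_eq_square)
    have "2 * z t * (Q t * w t) \<le> \<bar>Q t\<bar> * (2 * \<bar>w t\<bar> * \<bar>z t\<bar>)"
      using abs_ge_self[of "2 * z t * (Q t * w t)"] by (simp add: abs_mult algebra_simps)
    also have "\<dots> \<le> M * ((w t)\<^sup>2 + (z t)\<^sup>2)"
      using sum_squares_bound[of "\<bar>w t\<bar>" "\<bar>z t\<bar>"] Q[OF t] M by (intro mult_mono) auto
    finally have 2: "2 * z t * (Q t * w t) \<le> M * ((w t)\<^sup>2 + (z t)\<^sup>2)" .
    have "(f t)\<^sup>2 \<le> \<epsilon>\<^sup>2"
      using power_mono[OF f[OF t], of 2] by simp
    then have 3: "2 * z t * f t \<le> (z t)\<^sup>2 + \<epsilon>\<^sup>2"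
      using sum_squares_bound[of "z t" "f t"] by (simp add: power2_eq_square)
    have "M * \<epsilon>\<^sup>2 \<ge> 0" using M by simp
    then have "2 * w t * z t + 2 * z t * (Q t * w t + f t) - (M + 2) * ((w t)\<^sup>2 + (z t)\<^sup>2 + \<epsilon>\<^sup>2) \<le> 0"
      using 1 2 3 zero_le_power2[of "w t"] zero_le_power2[of "\<epsilon>"]
      unfolding distrib_left distrib_right by linarith
    then show ?thesis
      unfolding N'_def by (intro mult_nonpos_nonneg) auto
  qed
  have "N x \<le> N a"
  proof (rule DERIV_nonpos_imp_decreasing_open[where f = N])
    show "a \<le> x" using x by auto
    show "\<exists>y. (N has_real_derivative y) (at t) \<and> y \<le> 0" if "a < t" "t < x" for t
      using d[of t] N'0[of t] that x by (intro exI[of _ "N' t"]) (auto simp: at_within_Icc_at)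
    have "continuous_on {a..b} N" by (rule DERIV_continuous_on[OF d])
    then show "continuous_on {a..x} N"
      by (rule continuous_on_subset) (use x in auto)
  qed
  also have "N a = \<epsilon>\<^sup>2" by (simp add: N_def 0)
  finally have "((w x)\<^sup>2 + (z x)\<^sup>2 + \<epsilon>\<^sup>2) / exp ((M + 2) * (x - a)) \<le> \<epsilon>\<^sup>2"
    unfolding N_def mult_minus_left exp_minus divide_inverse .
  then have "(w x)\<^sup>2 + (z x)\<^sup>2 + \<epsilon>\<^sup>2 \<le> \<epsilon>\<^sup>2 * exp ((M + 2) * (x - a))"
    by (subst (asm) pos_divide_le_eq) auto
  also have "\<dots> \<le> \<epsilon>\<^sup>2 * exp ((M + 2) * (b - a))"
    using x M by (intro mult_left_mono) auto
  also have "\<dots> \<le> \<epsilon>\<^sup>2 * (exp ((M + 2) * (b - a)))\<^sup>2"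
    using x M by (intro mult_left_mono self_le_power) auto
  finally have *: "(w x)\<^sup>2 + (z x)\<^sup>2 + \<epsilon>\<^sup>2 \<le> (\<epsilon> * exp ((M + 2) * (b - a)))\<^sup>2"
    by (simp add: power_mult_distrib)
  have e': "0 \<le> \<epsilon> * exp ((M + 2) * (b - a))" using e by simp
  have "(w x)\<^sup>2 \<le> (\<epsilon> * exp ((M + 2) * (b - a)))\<^sup>2" "(z x)\<^sup>2 \<le> (\<epsilon> * exp ((M + 2) * (b - a)))\<^sup>2"
    using * zero_le_power2[of "w x"] zero_le_power2[of "z x"] zero_le_power2[of \<epsilon>] by linarith+
  then show "\<bar>w x\<bar> \<le> \<epsilon> * exp ((M + 2) * (b - a))" "\<bar>z x\<bar> \<le> \<epsilon> * exp ((M + 2) * (b - a))"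
    using e' by (auto dest: abs_le_square_iff[THEN iffD2])
qed

section \<open>Continuous dependence and Wronskians\<close>

definition ode_sol :: "real \<Rightarrow> real \<Rightarrow> real \<Rightarrow> (real \<Rightarrow> real) \<Rightarrow> (real \<Rightarrow> real) \<Rightarrow> bool" where
  "ode_sol g a b u v \<longleftrightarrow> (\<forall>x\<in>{a..b}.
     (u has_real_derivative v x) (at x within {a..b}) \<and>
     (v has_real_derivative (g\<^sup>2 * x\<^sup>2 - 1) * u x) (at x within {a..b}))"

lemma ode_solD:
  assumes "ode_sol g a b u v" "x \<in> {a..b}"
  shows "(u has_real_derivative v x) (at x within {a..b})"
    and "(v has_real_derivative (g\<^sup>2 * x\<^sup>2 - 1) * u x) (at x within {a..b})"
  using assms by (auto simp: ode_sol_def)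

lemma ode_sol_continuous:
  assumes "ode_sol g a b u v"
  shows "continuous_on {a..b} u" "continuous_on {a..b} v"
  using DERIV_continuous_on[OF ode_solD(1)[OF assms]] DERIV_continuous_on[OF ode_solD(2)[OF assms]]
  by auto

lemma ode_sol_osc: "ode_sol g a b (osc g A B) (osc' g A B)"
  unfolding ode_sol_def
  using osc_deriv[OF DERIV_ident] osc'_deriv[OF DERIV_ident] by simp

lemma ode_sol_combine:
  assumes "ode_sol g a b u1 v1" "ode_sol g a b u2 v2"
  shows "ode_sol g a b (\<lambda>x. p * u1 x + q * u2 x) (\<lambda>x. p * v1 x + q * v2 x)"
  using assms unfolding ode_sol_def
  by (auto intro!: derivative_eq_intros simp: algebra_simps)

lemma ode_sol_reflect:
  assumes "ode_sol g a b u v"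
  shows "ode_sol g (- b) (- a) (\<lambda>x. u (- x)) (\<lambda>x. - v (- x))"
proof -
  have eq: "uminus ` {- b..- a} = {a..b}" by simp
  have c: "((\<lambda>x. f (- x)) has_real_derivative - f') (at x within {- b..- a})"
    if "(f has_real_derivative f') (at (- x) within {a..b})" for f :: "real \<Rightarrow> real" and f' x
  proof -
    have "(f has_real_derivative f') (at (- x) within uminus ` {- b..- a})"
      using that by (simp only: eq)
    from DERIV_image_chain[OF this DERIV_minus[OF DERIV_ident]] show ?thesis
      by (simp only: o_def mult_minus1_right)
  qed
  show ?thesis
    unfolding ode_sol_def
  proof (intro ballI conjI)
    fix x assume x: "x \<in> {- b..- a}"
    then have mx: "- x \<in> {a..b}" by auto
    show "((\<lambda>x. u (- x)) has_real_derivative - v (- x)) (at x within {- b..- a})"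
      by (rule c[OF ode_solD(1)[OF assms mx]])
    show "((\<lambda>x. - v (- x)) has_real_derivative (g\<^sup>2 * x\<^sup>2 - 1) * u (- x)) (at x within {- b..- a})"
      using DERIV_minus[OF c[OF ode_solD(2)[OF assms mx]]] by simp
  qed
qed

lemma ode_potential_bound:
  fixes x :: real
  assumes "x \<in> {a..b}" "0 \<le> g" "g \<le> \<Gamma>"
  shows "x\<^sup>2 \<le> a\<^sup>2 + b\<^sup>2" "\<bar>g\<^sup>2 * x\<^sup>2 - 1\<bar> \<le> \<Gamma>\<^sup>2 * (a\<^sup>2 + b\<^sup>2) + 1"
proof -
  have "\<bar>x\<bar> \<le> \<bar>a\<bar> \<or> \<bar>x\<bar> \<le> \<bar>b\<bar>" using assms by auto
  then show x: "x\<^sup>2 \<le> a\<^sup>2 + b\<^sup>2"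
    unfolding abs_le_square_iff by (smt (verit) zero_le_power2)
  have "g\<^sup>2 * x\<^sup>2 \<le> \<Gamma>\<^sup>2 * (a\<^sup>2 + b\<^sup>2)"
    using x assms by (intro mult_mono power_mono) auto
  moreover have "g\<^sup>2 * x\<^sup>2 \<ge> 0" by simp
  ultimately show "\<bar>g\<^sup>2 * x\<^sup>2 - 1\<bar> \<le> \<Gamma>\<^sup>2 * (a\<^sup>2 + b\<^sup>2) + 1" by linarith
qed

text \<open>The difference \<open>u - u0\<close> has zero initial data and solves the equation for
  \<open>g\<close> with forcing term \<open>(g\<^sup>2 - g0\<^sup>2) * x\<^sup>2 * u0 x\<close>.
  That term is at most a constant times \<open>\<bar>g - g0\<bar>\<close>, and the Gronwall estimate
  keeps this with a constant independent of \<open>g\<close>.\<close>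

lemma ode_dependence:
  assumes u0: "ode_sol g0 a b u0 v0" and g0: "0 \<le> g0" "g0 \<le> \<Gamma>"
  shows "\<exists>C\<ge>0. \<forall>g u v. 0 \<le> g \<longrightarrow> g \<le> \<Gamma> \<longrightarrow> ode_sol g a b u v \<longrightarrow> u a = u0 a \<longrightarrow> v a = v0 a \<longrightarrow>
           (\<forall>x\<in>{a..b}. \<bar>u x - u0 x\<bar> \<le> C * \<bar>g - g0\<bar> \<and> \<bar>v x - v0 x\<bar> \<le> C * \<bar>g - g0\<bar>)"
proof -
  have "bounded (u0 ` {a..b})"
    using ode_sol_continuous[OF u0] by (intro compact_imp_bounded compact_continuous_image) auto
  then obtain U where U: "\<And>x. x \<in> {a..b} \<Longrightarrow> \<bar>u0 x\<bar> \<le> U" and U0: "U > 0"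
    unfolding bounded_pos by (metis image_eqI real_norm_def)
  define Y where "Y = a\<^sup>2 + b\<^sup>2"
  have Y: "Y \<ge> 0" by (simp add: Y_def)
  define C where "C = 2 * \<Gamma> * Y * U * exp ((\<Gamma>\<^sup>2 * Y + 1 + 2) * (b - a))"
  have C: "C \<ge> 0"
    unfolding C_def using g0 Y U0 by (intro mult_nonneg_nonneg) auto
  moreover have "\<bar>u x - u0 x\<bar> \<le> C * \<bar>g - g0\<bar> \<and> \<bar>v x - v0 x\<bar> \<le> C * \<bar>g - g0\<bar>"
    if g: "0 \<le> g" "g \<le> \<Gamma>" and u: "ode_sol g a b u v" and ic: "u a = u0 a" "v a = v0 a"
      and x: "x \<in> {a..b}" for g u v x
  proof -
    have gd: "\<bar>g\<^sup>2 - g0\<^sup>2\<bar> \<le> 2 * \<Gamma> * \<bar>g - g0\<bar>"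
    proof -
      have "\<bar>g\<^sup>2 - g0\<^sup>2\<bar> = (g + g0) * \<bar>g - g0\<bar>"
        using g g0 by (simp add: power2_eq_square square_diff_square_factored abs_mult)
      also have "\<dots> \<le> 2 * \<Gamma> * \<bar>g - g0\<bar>"
        using g g0 by (intro mult_right_mono) auto
      finally show ?thesis .
    qed
    have d1: "((\<lambda>x. u x - u0 x) has_real_derivative v x - v0 x) (at x within {a..b})"
      if "x \<in> {a..b}" for x
      by (intro derivative_intros ode_solD[OF u that] ode_solD[OF u0 that])
    have d2: "((\<lambda>x. v x - v0 x) has_real_derivative
        (g\<^sup>2 * x\<^sup>2 - 1) * (u x - u0 x) + (g\<^sup>2 - g0\<^sup>2) * x\<^sup>2 * u0 x) (at x within {a..b})"
      if "x \<in> {a..b}" for x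
      by (rule derivative_eq_intros ode_solD[OF u that] ode_solD[OF u0 that] refl)+
         (simp add: algebra_simps)
    have f: "\<bar>(g\<^sup>2 - g0\<^sup>2) * x\<^sup>2 * u0 x\<bar> \<le> 2 * \<Gamma> * \<bar>g - g0\<bar> * Y * U" if "x \<in> {a..b}" for x
      unfolding abs_mult using gd U[OF that] g Y ode_potential_bound(1)[OF that g]
      by (intro mult_mono) (auto simp: Y_def)
    have Q: "\<bar>g\<^sup>2 * x\<^sup>2 - 1\<bar> \<le> \<Gamma>\<^sup>2 * Y + 1" if "x \<in> {a..b}" for x
      using ode_potential_bound(2)[OF that g] by (simp add: Y_def)
    have 0: "u a - u0 a = 0" "v a - v0 a = 0" using ic by auto
    show ?thesis
      using linear_ode_bound[OF d1 d2 Q f 0 x] by (simp add: C_def mult_ac)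
  qed
  ultimately show ?thesis by blast
qed

lemma ode_unique:
  assumes "ode_sol g a b u1 v1" "ode_sol g a b u2 v2" "u1 a = u2 a" "v1 a = v2 a" "0 \<le> g" "x \<in> {a..b}"
  shows "u1 x = u2 x" "v1 x = v2 x"
proof -
  obtain C where "\<forall>g' u v. 0 \<le> g' \<longrightarrow> g' \<le> g \<longrightarrow> ode_sol g' a b u v \<longrightarrow> u a = u2 a \<longrightarrow> v a = v2 a \<longrightarrow>
      (\<forall>x\<in>{a..b}. \<bar>u x - u2 x\<bar> \<le> C * \<bar>g' - g\<bar> \<and> \<bar>v x - v2 x\<bar> \<le> C * \<bar>g' - g\<bar>)"
    using ode_dependence[OF assms(2) assms(5) order_refl] by blast
  from this[rule_format, OF assms(5) order_refl assms(1,3,4,6)]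
  show "u1 x = u2 x" "v1 x = v2 x" by auto
qed

text \<open>Used in two ways: for \<open>g1 = g2\<close> the Wronskian is constant, and for
  \<open>g1 < g2\<close> it increases as long as both solutions are positive.\<close>

lemma wronskian_deriv:
  assumes "ode_sol g1 a b u1 v1" "ode_sol g2 a b u2 v2" "x \<in> {a..b}"
  shows "((\<lambda>x. u1 x * v2 x - v1 x * u2 x) has_real_derivative
           (g2\<^sup>2 - g1\<^sup>2) * x\<^sup>2 * u1 x * u2 x) (at x within {a..b})"
  by (rule derivative_eq_intros ode_solD[OF assms(1,3)] ode_solD[OF assms(2,3)] refl)+
     (simp add: algebra_simps)

lemma wronskian_constant:
  assumes "ode_sol g a b u1 v1" "ode_sol g a b u2 v2" "x \<in> {a..b}" "y \<in> {a..b}"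
  shows "u1 x * v2 x - v1 x * u2 x = u1 y * v2 y - v1 y * u2 y"
proof -
  have "((\<lambda>x. u1 x * v2 x - v1 x * u2 x) has_field_derivative 0) (at x within {a..b})"
    if "x \<in> {a..b}" for x
    using wronskian_deriv[OF assms(1,2) that] by simp
  then have "\<exists>c. \<forall>x\<in>{a..b}. u1 x * v2 x - v1 x * u2 x = c"
    by (intro has_field_derivative_zero_constant convex_real_interval)
  then show ?thesis using assms(3,4) by metis
qed

section \<open>The even and odd solutions and their joint continuity\<close>

abbreviation "ev g \<equiv> osc g 1 0"
abbreviation "ev' g \<equiv> osc' g 1 0"
abbreviation "od g \<equiv> osc g 0 1"
abbreviation "od' g \<equiv> osc' g 0 1"

lemma wronskian_ev_od: "ev g y * od' g y - ev' g y * od g y = 1"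
  using wronskian_constant[OF ode_sol_osc ode_sol_osc, of y "min y 0" "max y 0" 0 g 1 0 0 1]
  by auto

text \<open>Reflection sends solutions to solutions, and uniqueness from the data at
  \<open>0\<close> identifies the reflected solution with \<open>ev\<close> itself and with the
  negative of \<open>od\<close>.\<close>

lemma
  assumes "0 \<le> g" "0 \<le> y"
  shows ev_minus: "ev g (- y) = ev g y" and ev'_minus: "ev' g (- y) = - ev' g y"
    and od_minus: "od g (- y) = - od g y" and od'_minus: "od' g (- y) = od' g y"
proof -
  have r: "ode_sol g 0 y (\<lambda>x. osc g A B (- x)) (\<lambda>x. - osc' g A B (- x))" for A B
    using ode_sol_reflect[OF ode_sol_osc[of g "- y" 0 A B]] by simp
  have y: "y \<in> {0..y}" using assms by simp
  show "ev g (- y) = ev g y" "ev' g (- y) = - ev' g y"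
    using ode_unique[OF r[of 1 0] ode_sol_osc[of g 0 y 1 0] _ _ assms(1) y] by auto
  \<comment> \<open>The negative of \<open>od g\<close> is written as a linear combination so that
    \<open>ode_sol_combine\<close> applies.\<close>
  have "ode_sol g 0 y (\<lambda>x. 0 * od g x + (-1) * od g x) (\<lambda>x. 0 * od' g x + (-1) * od' g x)"
    by (intro ode_sol_combine ode_sol_osc)
  from ode_unique[OF r[of 0 1] this _ _ assms(1) y]
  show "od g (- y) = - od g y" "od' g (- y) = od' g y" by auto
qed

text \<open>Each solution is continuous in \<open>y\<close> and Lipschitz in \<open>g\<close>
  uniformly in \<open>y\<close>; together this is joint continuity.\<close>

lemma osc_jointly_continuous:
  "continuous_on ({0..\<Gamma>} \<times> {0..Y}) (\<lambda>(g, y). osc g A B y)"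
  "continuous_on ({0..\<Gamma>} \<times> {0..Y}) (\<lambda>(g, y). osc' g A B y)"
proof -
  have joint: "continuous_on ({0..\<Gamma>} \<times> {0..Y}) (\<lambda>(g, y). F g y)"
    if cont: "\<And>g. continuous_on {0..Y} (F g)"
      and lip: "\<And>g0. 0 \<le> g0 \<Longrightarrow> g0 \<le> \<Gamma> \<Longrightarrow> \<exists>C\<ge>0. \<forall>g y. 0 \<le> g \<longrightarrow> g \<le> \<Gamma> \<longrightarrow> y \<in> {0..Y} \<longrightarrow>
                 \<bar>F g y - F g0 y\<bar> \<le> C * \<bar>g - g0\<bar>" for F :: "real \<Rightarrow> real \<Rightarrow> real"
    unfolding continuous_on_def
  proof (intro ballI)
    fix p assume p: "p \<in> {0..\<Gamma>} \<times> {0..Y}"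
    obtain g0 y0 where p0: "p = (g0, y0)" by (cases p)
    let ?F = "at p within {0..\<Gamma>} \<times> {0..Y}"
    obtain C where C: "\<And>g y. 0 \<le> g \<Longrightarrow> g \<le> \<Gamma> \<Longrightarrow> y \<in> {0..Y} \<Longrightarrow> \<bar>F g y - F g0 y\<bar> \<le> C * \<bar>g - g0\<bar>"
      using lip[of g0] p p0 by auto
    have "((\<lambda>q. F (fst q) (snd q) - F g0 (snd q)) \<longlongrightarrow> 0) ?F"
    proof (rule Lim_null_comparison)
      show "\<forall>\<^sub>F q in ?F. norm (F (fst q) (snd q) - F g0 (snd q)) \<le> C * \<bar>fst q - g0\<bar>"
        unfolding eventually_at_filter using C by (auto intro!: always_eventually)
      have "((\<lambda>q. C * \<bar>fst q - g0\<bar>) \<longlongrightarrow> C * \<bar>fst p - g0\<bar>) ?F"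
        by (intro tendsto_intros)
      then show "((\<lambda>q. C * \<bar>fst q - g0\<bar>) \<longlongrightarrow> 0) ?F" by (simp add: p0)
    qed
    moreover have "((\<lambda>q. F g0 (snd q)) \<longlongrightarrow> F g0 (snd p)) ?F"
    proof -
      have "continuous_on ({0..\<Gamma>} \<times> {0..Y}) (\<lambda>q. F g0 (snd q))"
        by (rule continuous_on_compose2[OF cont]) (auto intro!: continuous_intros)
      then show ?thesis using p by (auto simp: continuous_on_def)
    qed
    ultimately have "((\<lambda>q. F (fst q) (snd q) - F g0 (snd q) + F g0 (snd q)) \<longlongrightarrow> 0 + F g0 (snd p)) ?F"
      by (rule tendsto_add)
    then show "((\<lambda>(g, y). F g y) \<longlongrightarrow> (case p of (g, y) \<Rightarrow> F g y)) ?F"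
      by (simp add: p0 case_prod_beta')
  qed
  have dep: "\<exists>C\<ge>0. \<forall>g. 0 \<le> g \<longrightarrow> g \<le> \<Gamma> \<longrightarrow> (\<forall>y\<in>{0..Y}.
      \<bar>osc g A B y - osc g0 A B y\<bar> \<le> C * \<bar>g - g0\<bar> \<and> \<bar>osc' g A B y - osc' g0 A B y\<bar> \<le> C * \<bar>g - g0\<bar>)"
    if "0 \<le> g0" "g0 \<le> \<Gamma>" for g0
    using ode_dependence[OF ode_sol_osc[of g0 0 Y A B] that] ode_sol_osc[of _ 0 Y A B] osc_0 osc'_0
    by metis
  show "continuous_on ({0..\<Gamma>} \<times> {0..Y}) (\<lambda>(g, y). osc g A B y)"
  proof (rule joint)
    show "continuous_on {0..Y} (osc g A B)" for g
      by (rule continuous_on_osc[OF continuous_on_id])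
  qed (use dep in meson)
  show "continuous_on ({0..\<Gamma>} \<times> {0..Y}) (\<lambda>(g, y). osc' g A B y)"
  proof (rule joint)
    show "continuous_on {0..Y} (osc' g A B)" for g
      by (rule continuous_on_osc'[OF continuous_on_id])
  qed (use dep in meson)
qed

section \<open>The odd solution\<close>

text \<open>At the first point where \<open>f \<le> c\<close>, the intermediate value theorem forces
  \<open>f = c\<close>, and \<open>f \<ge> c\<close> holds up to it; \<open>step\<close> then makes
  the value there exceed \<open>c\<close>.\<close>

lemma real_bootstrap:
  fixes f :: "real \<Rightarrow> real"
  assumes cont: "continuous_on {0..y} f" and "f 0 > c" and "0 \<le> y"
    and step: "\<And>t. \<lbrakk>0 \<le> t; t \<le> y; \<forall>s\<in>{0..t}. f s \<ge> c\<rbrakk> \<Longrightarrow> f t > c"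
  shows "f y > c"
proof (rule ccontr)
  assume "\<not> f y > c"
  define S where "S = {0..y} \<inter> f -` {..c}"
  have "closed S"
    unfolding S_def by (intro continuous_closed_preimage cont) auto
  then have "compact S"
    unfolding S_def by (metis bounded_Int bounded_closed_interval box_real(2) compact_eq_bounded_closed)
  moreover have "y \<in> S"
    using \<open>\<not> f y > c\<close> \<open>0 \<le> y\<close> by (auto simp: S_def)
  ultimately obtain t where t: "t \<in> S" "\<And>s. s \<in> S \<Longrightarrow> t \<le> s"
    using compact_attains_inf[of S] by blast
  have ft: "f t \<le> c" "0 \<le> t" "t \<le> y" using t(1) by (auto simp: S_def)
  have "\<exists>s. 0 \<le> s \<and> s \<le> t \<and> f s = c"
    by (rule IVT2') (use ft assms in \<open>auto intro: continuous_on_subset[OF cont]\<close>)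
  then obtain s where s: "0 \<le> s" "s \<le> t" "f s = c" by blast
  then have "t \<le> s" using t(2)[of s] ft by (auto simp: S_def)
  then have "f t = c" using s by simp
  moreover have "f t > c"
  proof (rule step)
    show "\<forall>s\<in>{0..t}. f s \<ge> c"
    proof
      fix s assume "s \<in> {0..t}"
      then show "f s \<ge> c"
        using t(2)[of s] ft \<open>f t = c\<close> by (cases "f s \<le> c") (auto simp: S_def)
    qed
  qed (use ft in auto)
  ultimately show False by simp
qed

lemma deriv_compare:
  fixes f h :: "real \<Rightarrow> real"
  assumes "a \<le> b"
    and f: "\<And>x. a \<le> x \<Longrightarrow> x \<le> b \<Longrightarrow> (f has_real_derivative f' x) (at x)"
    and h: "\<And>x. a \<le> x \<Longrightarrow> x \<le> b \<Longrightarrow> (h has_real_derivative h' x) (at x)"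
    and le: "\<And>x. a \<le> x \<Longrightarrow> x \<le> b \<Longrightarrow> f' x \<le> h' x"
  shows "f b - f a \<le> h b - h a"
proof -
  have "h a - f a \<le> h b - f b"
    by (rule DERIV_nonneg_imp_nondecreasing[OF \<open>a \<le> b\<close>, where f = "\<lambda>x. h x - f x"])
       (use f h le in \<open>fastforce intro!: derivative_eq_intros\<close>)
  then show ?thesis by simp
qed

lemma osc_derivs:
  "(osc g A B has_real_derivative osc' g A B y) (at y within S)"
  "(osc' g A B has_real_derivative (g\<^sup>2 * y\<^sup>2 - 1) * osc g A B y) (at y within S)"
  using osc_deriv[OF DERIV_ident] osc'_deriv[OF DERIV_ident] by simp_all

text \<open>Up to \<open>1 / g\<close> the potential lies between \<open>-1\<close> and
  \<open>0\<close>. Hence \<open>od'\<close> is at most \<open>1\<close>, so \<open>od\<close> is at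
  most \<open>t\<close>, so the second derivative is at least \<open>- t\<close>, and integration
  gives the bound.\<close>

lemma od'_concave_bound:
  assumes g: "g \<ge> 1" and y: "0 \<le> y" "y \<le> 1 / g" and pos: "\<And>t. 0 \<le> t \<Longrightarrow> t \<le> y \<Longrightarrow> od g t \<ge> 0"
  shows "od' g y \<ge> 1 - y\<^sup>2 / 2"
proof -
  have Q: "g\<^sup>2 * t\<^sup>2 \<le> 1" if "0 \<le> t" "t \<le> y" for t
  proof -
    have "g * t \<le> g * y" using that g by (intro mult_left_mono) auto
    also have "\<dots> \<le> 1" using y g by (simp add: field_simps)
    finally have "g * t \<le> 1" .
    then have "(g * t)\<^sup>2 \<le> 1" using that g by (intro power_le_one) auto
    then show ?thesis by (simp add: power_mult_distrib)
  qed
  have od': "od' g t \<le> 1" if "0 \<le> t" "t \<le> y" for t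
    using deriv_compare[of 0 t "od' g" _ "\<lambda>_. 0" "\<lambda>_. 0", OF that(1) osc_derivs(2)] Q pos that
    by (force simp: mult_nonpos_nonneg)
  have od: "od g t \<le> t" if "0 \<le> t" "t \<le> y" for t
    using deriv_compare[of 0 t "od g" _ "\<lambda>x. x" "\<lambda>_. 1", OF that(1) osc_derivs(1)] od' that
    by force
  have "(- (y\<^sup>2 / 2)) - (- (0\<^sup>2 / 2)) \<le> od' g y - od' g 0"
  proof (rule deriv_compare[OF y(1) _ osc_derivs(2)])
    fix t assume t: "0 \<le> t" "t \<le> y"
    show "((\<lambda>y. - (y\<^sup>2 / 2)) has_real_derivative - t) (at t)"
      by (auto intro!: derivative_eq_intros)
    have "(g\<^sup>2 * t\<^sup>2) * od g t \<ge> 0" using pos[OF t] by simp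
    then show "- t \<le> (g\<^sup>2 * t\<^sup>2 - 1) * od g t"
      using od[OF t] by (simp add: algebra_simps)
  qed
  then show ?thesis by simp
qed

text \<open>As long as \<open>od' g \<ge> 1 / 4\<close>, the function \<open>od g\<close> is
  nonnegative. Then the slope is at least \<open>1 / 2\<close> up to the turning point
  \<open>1 / g\<close> and does not decrease after it, which improves the assumed bound.\<close>

lemma od'_lower:
  assumes g: "g \<ge> 1" and y: "0 \<le> y"
  shows "od' g y > 1 / 4"
proof (rule real_bootstrap[OF _ _ y])
  show "continuous_on {0..y} (od' g)" by (intro continuous_on_osc' continuous_on_id)
  fix t assume t: "0 \<le> t" "t \<le> y" "\<forall>s\<in>{0..t}. od' g s \<ge> 1 / 4"
  have pos: "od g s \<ge> 0" if "0 \<le> s" "s \<le> t" for s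
  proof -
    have "0 - 0 \<le> od g s - od g 0"
    proof (rule deriv_compare[where f = "\<lambda>_. 0" and f' = "\<lambda>_. 0", OF that(1) _ osc_derivs(1)])
      fix x assume "0 \<le> x" "x \<le> s"
      then have "od' g x \<ge> 1 / 4" using t(3) that by auto
      then show "0 \<le> od' g x" by simp
    qed auto
    then show ?thesis by simp
  qed
  have half: "od' g s \<ge> 1 / 2" if "0 \<le> s" "s \<le> t" "s \<le> 1 / g" for s
  proof -
    have "s \<le> 1" using that g by (smt (verit) divide_le_eq_1)
    then have "s\<^sup>2 \<le> 1" using that by (simp add: power_le_one)
    then show ?thesis using od'_concave_bound[OF g that(1,3)] pos that by force
  qed
  show "od' g t > 1 / 4"
  proof (cases "t \<le> 1 / g")
    case True
    then show ?thesis using half[of t] t by simp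
  next
    case False
    have "0 - 0 \<le> od' g t - od' g (1 / g)"
    proof (rule deriv_compare[where f = "\<lambda>_. 0" and f' = "\<lambda>_. 0", OF _ _ osc_derivs(2)])
      fix s assume s: "1 / g \<le> s" "s \<le> t"
      have "g * s \<ge> 1" using s g by (simp add: field_simps)
      then have "(g * s)\<^sup>2 \<ge> 1" by (simp add: one_le_power)
      moreover have "0 \<le> s" using s g by (smt (verit) divide_nonneg_nonneg)
      ultimately show "0 \<le> (g\<^sup>2 * s\<^sup>2 - 1) * od g s"
        using pos[of s] s by (simp add: power_mult_distrib)
    qed (use False in auto)
    then show ?thesis using half[of "1 / g"] False g by (simp add: field_simps)
  qed
qed auto

section \<open>Growth bounds for the odd solution\<close>

lemma od_lower:
  assumes g: "g \<ge> 1" and y: "0 \<le> y"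
  shows "od g y \<ge> y / 4"
  using deriv_compare[of 0 y "\<lambda>x. x / 4" "\<lambda>_. 1 / 4" "od g", OF y _ osc_derivs(1)] od'_lower[OF g]
  by (force intro!: derivative_eq_intros)

lemma od_nonneg: "g \<ge> 1 \<Longrightarrow> 0 \<le> y \<Longrightarrow> od g y \<ge> 0"
  using od_lower[of g y] by simp

lemma od_pos: "g \<ge> 1 \<Longrightarrow> 0 < y \<Longrightarrow> od g y > 0"
  using od_lower[of g y] by simp

lemma od'_pos: "g \<ge> 1 \<Longrightarrow> 0 \<le> y \<Longrightarrow> od' g y > 0"
  using od'_lower[of g y] by simp

lemma od'_lower_core:
  assumes "g \<ge> 1" "0 \<le> y" "y \<le> 1 / g"
  shows "od' g y \<ge> 1 / 2"
proof -
  have "y \<le> 1" using assms by (smt (verit) divide_le_eq_1)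
  then have "y\<^sup>2 \<le> 1" using assms by (simp add: power_le_one)
  then show ?thesis
    using od'_concave_bound[OF assms] od_nonneg[OF assms(1)] by force
qed

lemma sq_prod_ge_1:
  fixes g y :: real
  assumes "g \<ge> 1" "1 / g \<le> y"
  shows "1 \<le> g\<^sup>2 * y\<^sup>2"
proof -
  have "1 \<le> g * y" using assms by (simp add: field_simps)
  then have "1 \<le> (g * y)\<^sup>2" by (simp add: one_le_power)
  then show ?thesis by (simp add: power_mult_distrib)
qed

lemma sq_prod_le_1:
  fixes g y :: real
  assumes "g \<ge> 1" "0 \<le> y" "y \<le> 1 / g"
  shows "g\<^sup>2 * y\<^sup>2 \<le> 1"
proof -
  have "g * y \<le> 1" using assms by (simp add: field_simps)
  then have "(g * y)\<^sup>2 \<le> 1" using assms by (intro power_le_one) auto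
  then show ?thesis by (simp add: power_mult_distrib)
qed

text \<open>Every slope before \<open>y\<close> is at most \<open>4 * od' g y\<close>: up to
  \<open>1 / g\<close> it is at most \<open>1\<close>, while \<open>od' g y > 1 / 4\<close>, and
  beyond \<open>1 / g\<close> it does not decrease. Integrating from \<open>0\<close> gives the
  claim.\<close>

lemma od_upper:
  assumes g: "g \<ge> 1" and y: "0 \<le> y"
  shows "od g y \<le> 4 * y * od' g y"
proof -
  have le: "od' g t \<le> 4 * od' g y" if t: "0 \<le> t" "t \<le> y" for t
  proof (cases "t \<le> 1 / g")
    case True
    have "od' g t - od' g 0 \<le> 0 - 0"
    proof (rule deriv_compare[where h = "\<lambda>_. 0" and h' = "\<lambda>_. 0", OF t(1) osc_derivs(2)])
      fix x assume "0 \<le> x" "x \<le> t"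
      then show "(g\<^sup>2 * x\<^sup>2 - 1) * od g x \<le> 0"
        using sq_prod_le_1[OF g] od_nonneg[OF g] True by (simp add: mult_nonpos_nonneg)
    qed auto
    then show ?thesis using od'_lower[OF g y] by simp
  next
    case False
    have "0 - 0 \<le> od' g y - od' g t"
    proof (rule deriv_compare[where f = "\<lambda>_. 0" and f' = "\<lambda>_. 0", OF t(2) _ osc_derivs(2)])
      fix x assume "t \<le> x" "x \<le> y"
      then show "0 \<le> (g\<^sup>2 * x\<^sup>2 - 1) * od g x"
        using sq_prod_ge_1[OF g, of x] od_nonneg[OF g, of x] False t by simp
    qed auto
    then show ?thesis using od'_pos[OF g y] by simp
  qed
  have "od g y - od g 0 \<le> 4 * od' g y * y - 4 * od' g y * 0"
    by (rule deriv_compare[OF y osc_derivs(1), where h' = "\<lambda>_. 4 * od' g y"])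
       (auto intro!: derivative_eq_intros le)
  then show ?thesis by (simp add: mult_ac)
qed

text \<open>By \<open>od_upper\<close>, the derivative of \<open>od'\<close> is at most
  \<open>4 * g\<^sup>2 * y ^ 3 * od' g y\<close>; the exponent is the primitive of
  \<open>4 * g\<^sup>2 * y ^ 3\<close>.\<close>

lemma od'_upper:
  assumes g: "g \<ge> 1" and y: "0 \<le> y"
  shows "od' g y \<le> exp (g\<^sup>2 * y ^ 4)"
proof -
  have "od' g y * exp (- (g\<^sup>2 * y ^ 4)) - od' g 0 * exp (- (g\<^sup>2 * 0 ^ 4)) \<le> 0 - 0"
  proof (rule deriv_compare[where h = "\<lambda>_. 0" and h' = "\<lambda>_. 0", OF y])
    fix x assume x: "0 \<le> x" "x \<le> y"
    show "((\<lambda>y. od' g y * exp (- (g\<^sup>2 * y ^ 4))) has_real_derivative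
        (g\<^sup>2 * x\<^sup>2 * (od g x - 4 * x * od' g x) - od g x) * exp (- (g\<^sup>2 * x ^ 4))) (at x)"
      by (rule derivative_eq_intros osc_derivs refl)+ (simp add: algebra_simps power2_eq_square power3_eq_cube)
    show "(g\<^sup>2 * x\<^sup>2 * (od g x - 4 * x * od' g x) - od g x) * exp (- (g\<^sup>2 * x ^ 4)) \<le> 0"
    proof (rule mult_nonpos_nonneg)
      have "g\<^sup>2 * x\<^sup>2 * (od g x - 4 * x * od' g x) \<le> 0"
        using od_upper[OF g x(1)] by (intro mult_nonneg_nonpos) auto
      then show "g\<^sup>2 * x\<^sup>2 * (od g x - 4 * x * od' g x) - od g x \<le> 0"
        using od_nonneg[OF g x(1)] by linarith
    qed simp
  qed auto
  then show ?thesis by (simp add: exp_minus field_simps)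
qed

text \<open>The defect \<open>Z = (g y\<^sup>2 + 1) O - y O'\<close> satisfies \<open>Z' = - g y Z + (3 g + 1) y O\<close>.\<close>

lemma od_log_deriv_bound:
  assumes g: "g \<ge> 1" and y: "0 \<le> y"
  shows "y * od' g y \<le> (g * y\<^sup>2 + 1) * od g y"
proof -
  define Z where "Z = (\<lambda>y. (g * y\<^sup>2 + 1) * od g y - y * od' g y)"
  have "0 - 0 \<le> Z y * exp (g / 2 * y\<^sup>2) - Z 0 * exp (g / 2 * 0\<^sup>2)"
  proof (rule deriv_compare[where f = "\<lambda>_. 0" and f' = "\<lambda>_. 0", OF y])
    fix x assume x: "0 \<le> x" "x \<le> y"
    show "((\<lambda>y. Z y * exp (g / 2 * y\<^sup>2)) has_real_derivative
        (3 * g + 1) * x * od g x * exp (g / 2 * x\<^sup>2)) (at x)"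
      unfolding Z_def
      by (rule derivative_eq_intros osc_derivs refl)+ (simp add: algebra_simps power2_eq_square)
    show "0 \<le> (3 * g + 1) * x * od g x * exp (g / 2 * x\<^sup>2)"
      using od_nonneg[OF g x(1)] x g by simp
  qed auto
  then have "Z y \<ge> 0" by (simp add: Z_def zero_le_mult_iff)
  then show ?thesis by (simp add: Z_def)
qed

text \<open>Since \<open>od g x \<ge> x / 4\<close>, the derivative of \<open>od'\<close> is at
  least \<open>(x\<^sup>2 - 1) * (x / 4)\<close> from \<open>1\<close> on. For
  \<open>y \<ge> 2\<close> the quadratic term of the primitive costs at most half of the quartic
  one.\<close>

lemma od'_growth:
  assumes g: "g \<ge> 1" and y: "2 \<le> y"
  shows "od' g y \<ge> y ^ 4 / 32"
proof -
  have "(1 / 16 * y ^ 4 - 1 / 8 * y\<^sup>2) - (1 / 16 * 1 ^ 4 - 1 / 8 * 1\<^sup>2) \<le> od' g y - od' g 1"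
  proof (rule deriv_compare[OF _ _ osc_derivs(2)])
    fix x :: real assume x: "1 \<le> x" "x \<le> y"
    show "((\<lambda>x. 1 / 16 * x ^ 4 - 1 / 8 * x\<^sup>2) has_real_derivative (x\<^sup>2 - 1) * (x / 4)) (at x)"
      by (rule derivative_eq_intros refl)+ (simp add: field_simps power2_eq_square power3_eq_cube)
    have "1 * x\<^sup>2 \<le> g\<^sup>2 * x\<^sup>2" using g by (intro mult_right_mono) (auto simp: one_le_power)
    moreover have "1 \<le> x\<^sup>2" using x by (simp add: one_le_power)
    ultimately have "x\<^sup>2 - 1 \<le> g\<^sup>2 * x\<^sup>2 - 1" "0 \<le> g\<^sup>2 * x\<^sup>2 - 1" by linarith+
    then show "(x\<^sup>2 - 1) * (x / 4) \<le> (g\<^sup>2 * x\<^sup>2 - 1) * od g x"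
      using od_lower[OF g, of x] x by (intro mult_mono) auto
  qed (use y in auto)
  moreover have "od' g 1 > 0" by (rule od'_pos[OF g]) simp
  moreover have "1 / 16 * y ^ 4 - 1 / 8 * y\<^sup>2 \<ge> y ^ 4 / 32"
  proof -
    have "4 * y\<^sup>2 \<le> y\<^sup>2 * y\<^sup>2"
      using power_mono[OF y, of 2] by (intro mult_right_mono) auto
    then show ?thesis by (simp add: power4_eq_xxxx power2_eq_square)
  qed
  ultimately show ?thesis by simp
qed

section \<open>The slope function and its derivative\<close>

text \<open>\<open>eta g y\<close> is the slope at \<open>0\<close> of the solution with value \<open>1\<close> at \<open>0\<close> and zero slope at \<open>y\<close>.\<close>

definition eta :: "real \<Rightarrow> real \<Rightarrow> real" where
  "eta g y = - ev' g y / od' g y"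

definition gam :: "real \<Rightarrow> real \<Rightarrow> real" where
  "gam g y = (g\<^sup>2 * y\<^sup>2 - 1) / (od' g y)\<^sup>2"

lemma eta_0 [simp]: "eta g 0 = 0"
  by (simp add: eta_def)

text \<open>The quotient rule leaves the Wronskian of \<open>ev\<close> and \<open>od\<close>, which
  is \<open>1\<close>, in the numerator.\<close>

lemma eta_deriv:
  assumes "g \<ge> 1" "0 \<le> y"
  shows "(eta g has_real_derivative - gam g y) (at y)"
proof -
  have nz: "od' g y \<noteq> 0" using od'_pos[OF assms] by simp
  have "(eta g has_real_derivative
      ((g\<^sup>2 * y\<^sup>2 - 1) * (ev' g y * od g y - ev g y * od' g y)) / (od' g y)\<^sup>2) (at y)"
  proof -
    have "(eta g has_real_derivative
        (- ((g\<^sup>2 * y\<^sup>2 - 1) * ev g y) * od' g y - - ev' g y * ((g\<^sup>2 * y\<^sup>2 - 1) * od g y))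
          / (od' g y * od' g y)) (at y)"
      unfolding eta_def [abs_def] by (intro DERIV_divide DERIV_minus osc_derivs nz)
    then show ?thesis
      by (rule back_subst) (simp add: algebra_simps power2_eq_square)
  qed
  also have "ev' g y * od g y - ev g y * od' g y = - 1"
    using wronskian_ev_od[of g y] by simp
  finally show ?thesis by (simp add: gam_def minus_divide_left)
qed

text \<open>The second term keeps the factor \<open>gam g y\<close>, so that smallness of
  \<open>gam\<close> can be used to bound it.\<close>

lemma gam_deriv:
  assumes "g \<ge> 1" "0 \<le> y"
  shows "(gam g has_real_derivative
           2 * g\<^sup>2 * y / (od' g y)\<^sup>2 - 2 * gam g y * ((g\<^sup>2 * y\<^sup>2 - 1) * od g y / od' g y)) (at y)"
proof -
  have nz: "od' g y \<noteq> 0" using od'_pos[OF assms] by simp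
  show ?thesis
  proof -
    have num: "((\<lambda>y. g\<^sup>2 * y\<^sup>2 - 1) has_real_derivative 2 * g\<^sup>2 * y) (at y)"
      by (rule derivative_eq_intros refl)+ simp
    have den: "((\<lambda>y. (od' g y)\<^sup>2) has_real_derivative 2 * od' g y * ((g\<^sup>2 * y\<^sup>2 - 1) * od g y)) (at y)"
      by (rule derivative_eq_intros osc_derivs refl)+ simp
    have "(gam g has_real_derivative
        (2 * g\<^sup>2 * y * (od' g y)\<^sup>2 - (g\<^sup>2 * y\<^sup>2 - 1) * (2 * od' g y * ((g\<^sup>2 * y\<^sup>2 - 1) * od g y)))
          / ((od' g y)\<^sup>2 * (od' g y)\<^sup>2)) (at y)"
      unfolding gam_def [abs_def] by (rule DERIV_divide[OF num den]) (use nz in simp)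
    then show ?thesis
      by (rule back_subst) (simp add: nz gam_def field_simps power2_eq_square)
  qed
qed

lemma gam_pos: "g \<ge> 1 \<Longrightarrow> 1 < g * y \<Longrightarrow> 0 \<le> y \<Longrightarrow> gam g y > 0"
  using one_less_power[of "g * y" 2] od'_pos[of g y]
  by (simp add: gam_def power_mult_distrib)

lemma gam_nonpos: "g \<ge> 1 \<Longrightarrow> 0 \<le> y \<Longrightarrow> y \<le> 1 / g \<Longrightarrow> gam g y \<le> 0"
  using sq_prod_le_1[of g y] by (simp add: gam_def divide_nonpos_nonneg)

lemma continuous_on_gam: "g \<ge> 1 \<Longrightarrow> S \<subseteq> {0..} \<Longrightarrow> continuous_on S (gam g)"
  unfolding gam_def [abs_def]
  by (intro continuous_intros) (use od'_pos in force)

text \<open>With \<open>O = od g\<close>, the derivative has the sign of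
  \<open>g\<^sup>2 x O' - (g\<^sup>2 x\<^sup>2 - 1)\<^sup>2 O\<close>. The bound on
  \<open>x O' / O\<close> from \<open>od_log_deriv_bound\<close> reduces its negativity to an
  inequality in \<open>X = g * x\<^sup>2\<close>, which holds because \<open>x \<ge> 2\<close> makes
  \<open>X \<ge> 4\<close>.\<close>

lemma gam_strict_decreasing:
  assumes g: "g \<ge> 1" and y: "2 \<le> y" "y < z"
  shows "gam g z < gam g y"
proof (rule DERIV_neg_imp_decreasing[OF y(2)])
  fix x assume "y \<le> x" "x \<le> z"
  then have x: "2 \<le> x" using y by simp
  let ?q = "g\<^sup>2 * x\<^sup>2 - 1"
  have O: "od g x > 0" "od' g x > 0" using od_pos[OF g] od'_pos[OF g] x by auto
  have "g\<^sup>2 * (x * od' g x) \<le> g\<^sup>2 * ((g * x\<^sup>2 + 1) * od g x)"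
    using od_log_deriv_bound[OF g, of x] x by (intro mult_left_mono) auto
  also have "\<dots> < ?q\<^sup>2 * od g x"
  proof -
    define X where "X = g * x\<^sup>2"
    have "2\<^sup>2 \<le> x\<^sup>2" using x by (intro power_mono) auto
    then have X: "X \<ge> 4" using mult_mono[of 1 g 4 "x\<^sup>2"] g by (simp add: X_def)
    have "X + 1 < (X - 1)\<^sup>2"
      using mult_right_mono[of 4 X X] X by (simp add: power2_eq_square algebra_simps)
    then have "g\<^sup>2 * (X + 1) < g\<^sup>2 * (X - 1)\<^sup>2" using g by simp
    also have "\<dots> = (g * (X - 1))\<^sup>2" by (simp add: power_mult_distrib)
    also have "\<dots> \<le> (g * X - 1)\<^sup>2"
    proof (rule power_mono)
      show "g * (X - 1) \<le> g * X - 1" using g by (simp add: algebra_simps)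
    qed (use g X in auto)
    also have "g * X - 1 = ?q" by (simp add: X_def power2_eq_square algebra_simps)
    finally have "g\<^sup>2 * (g * x\<^sup>2 + 1) < ?q\<^sup>2" by (simp add: X_def)
    then show ?thesis using O by simp
  qed
  finally have *: "g\<^sup>2 * x * od' g x < ?q\<^sup>2 * od g x" by (simp add: mult_ac)
  have "2 * g\<^sup>2 * x / (od' g x)\<^sup>2 - 2 * gam g x * (?q * od g x / od' g x)
      = 2 * (g\<^sup>2 * x * od' g x - ?q\<^sup>2 * od g x) / (od' g x) ^ 3"
    using O by (simp add: gam_def field_simps power2_eq_square power3_eq_cube)
  also have "\<dots> < 0" using * O by (simp add: divide_neg_pos)
  finally show "\<exists>y. (gam g has_real_derivative y) (at x) \<and> y < 0"
    using gam_deriv[OF g, of x] x by auto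
qed

text \<open>The quotient of this solution by \<open>od g\<close> has derivative
  \<open>- 1 / (od g t)\<^sup>2\<close>, and at \<open>y\<close> the solution equals
  \<open>1 / od' g y > 0\<close>. So the quotient is positive to the left of \<open>y\<close>; at
  \<open>0\<close> the solution is \<open>1\<close>.\<close>

lemma shooting_solution_pos:
  assumes g: "g \<ge> 1" and x: "0 \<le> x" "x \<le> y"
  shows "ev g x + eta g y * od g x > 0"
proof (cases "x = 0")
  case False
  then have x0: "x > 0" using x by simp
  let ?u = "\<lambda>x. ev g x + eta g y * od g x"
  have "?u y / od g y - ?u x / od g x \<le> 0 - 0"
  proof (rule deriv_compare[where h = "\<lambda>_. 0" and h' = "\<lambda>_. 0", OF x(2)])
    fix t assume t: "x \<le> t" "t \<le> y"
    then have O: "od g t > 0" using od_pos[OF g, of t] x0 by simp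
    have "((\<lambda>x. ?u x / od g x) has_real_derivative
        (ev' g t * od g t - ev g t * od' g t) / (od g t)\<^sup>2) (at t)"
    proof -
      have "((\<lambda>x. ?u x / od g x) has_real_derivative
          ((ev' g t + eta g y * od' g t) * od g t - ?u t * od' g t) / (od g t * od g t)) (at t)"
        by (intro DERIV_divide DERIV_add DERIV_cmult osc_derivs) (use O in simp)
      then show ?thesis by (simp add: algebra_simps power2_eq_square)
    qed
    also have "ev' g t * od g t - ev g t * od' g t = - 1"
      using wronskian_ev_od[of g t] by simp
    finally show "((\<lambda>x. ?u x / od g x) has_real_derivative - 1 / (od g t)\<^sup>2) (at t)" .
  qed auto
  moreover have "?u y = 1 / od' g y"
    using wronskian_ev_od[of g y] od'_pos[OF g, of y] x
    by (simp add: eta_def field_simps)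
  moreover have "od g y > 0" "od' g y > 0" "od g x > 0"
    using od_pos[OF g] od'_pos[OF g] x0 x by auto
  ultimately show ?thesis
    by (smt (verit) divide_pos_pos zero_less_divide_iff)
qed simp

text \<open>The two solutions with value \<open>1\<close> at \<open>0\<close> and zero slope at
  \<open>y\<close> are positive, so their Wronskian increases on \<open>[0, y]\<close>. It vanishes
  at \<open>y\<close> and equals \<open>eta g2 y - eta g1 y\<close> at \<open>0\<close>.\<close>

lemma eta_strict_antimono:
  assumes g: "1 \<le> g1" "g1 < g2" and y: "0 < y"
  shows "eta g2 y < eta g1 y"
proof -
  let ?u = "\<lambda>g x. 1 * ev g x + eta g y * od g x" and ?v = "\<lambda>g x. 1 * ev' g x + eta g y * od' g x"
  have sol: "ode_sol g 0 y (?u g) (?v g)" for g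
    by (intro ode_sol_combine ode_sol_osc)
  let ?W = "\<lambda>x. ?u g1 x * ?v g2 x - ?v g1 x * ?u g2 x"
  note W = wronskian_deriv[OF sol sol, of _ g1 g2]
  have "?W 0 < ?W y"
  proof (rule DERIV_pos_imp_increasing_open[OF y])
    show "continuous_on {0..y} ?W"
      by (rule DERIV_continuous_on[OF W])
    fix x assume x: "0 < x" "x < y"
    have "(g2\<^sup>2 - g1\<^sup>2) * x\<^sup>2 * ?u g1 x * ?u g2 x > 0"
      using shooting_solution_pos[of g1 x y] shooting_solution_pos[of g2 x y] g x
        power_strict_mono[of g1 g2 2] by simp
    then show "\<exists>d. (?W has_real_derivative d) (at x) \<and> 0 < d"
      using W[of x] x by (auto simp: at_within_Icc_at)
  qed
  moreover have "?v g y = 0" if "g \<ge> 1" for g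
    using od'_pos[OF that, of y] y by (simp add: eta_def)
  ultimately show ?thesis using g by simp
qed

lemma eta_antimono: "1 \<le> g1 \<Longrightarrow> g1 \<le> g2 \<Longrightarrow> 0 \<le> y \<Longrightarrow> eta g2 y \<le> eta g1 y"
  using eta_strict_antimono[of g1 g2 y] by (cases "g1 = g2"; cases "y = 0") auto

text \<open>For \<open>g = 1\<close> the even solution is a Gaussian, whose slope at
  \<open>y > 0\<close> is negative.\<close>

lemma eta_1_pos:
  assumes "y > 0"
  shows "eta 1 y > 0"
proof -
  have "ode_sol 1 0 y (\<lambda>x. exp (- (x\<^sup>2 / 2))) (\<lambda>x. - x * exp (- (x\<^sup>2 / 2)))"
    unfolding ode_sol_def
    by (auto intro!: derivative_eq_intros simp: field_simps power2_eq_square)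
  from ode_unique(2)[OF this ode_sol_osc[of 1 0 y 1 0], of y] assms
  have "ev' 1 y = - y * exp (- (y\<^sup>2 / 2))" by simp
  then show ?thesis
    using assms od'_pos[of 1 y] by (simp add: eta_def)
qed

text \<open>The slope of \<open>eta 256\<close> is at most \<open>4\<close> up to
  \<open>1 / 256\<close>, and afterwards the function does not increase, so it never exceeds
  \<open>1 / 64\<close>. Between \<open>1 / 32\<close> and \<open>1 / 16\<close> it loses at least
  \<open>7 / 32\<close>, and \<open>b\<close> lies beyond. Hence the sum is at most
  \<open>1 / 64 + 1 / 64 - 7 / 32\<close>.\<close>

lemma eta_256_sum_neg:
  assumes "0 \<le> s" "1 \<le> b"
  shows "eta 256 s + eta 256 b < 0"
proof -
  have dec: "eta 256 z \<le> eta 256 y" if "1 / 256 \<le> y" "y \<le> z" for y z :: real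
  proof -
    have "eta 256 z - eta 256 y \<le> 0 - 0"
    proof (rule deriv_compare[OF that(2) eta_deriv, where h = "\<lambda>_. 0" and h' = "\<lambda>_. 0"])
      fix x assume "y \<le> x" "x \<le> z"
      then have "1 \<le> 256\<^sup>2 * x\<^sup>2" using sq_prod_ge_1[of 256 x] that by simp
      then show "- gam 256 x \<le> 0" by (simp add: gam_def)
    qed (use that in auto)
    then show ?thesis by simp
  qed
  have core: "eta 256 y \<le> 1 / 64" if y: "0 \<le> y" "y \<le> 1 / 256" for y :: real
  proof -
    have "eta 256 y - eta 256 0 \<le> 4 * y - 4 * 0"
    proof (rule deriv_compare[OF y(1) eta_deriv, where h' = "\<lambda>_. 4"])
      fix x :: real assume x: "0 \<le> x" "x \<le> y"
      have "od' 256 x \<ge> 1 / 2" using od'_lower_core[of 256 x] x y by simp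
      then have "(od' 256 x)\<^sup>2 \<ge> (1 / 2)\<^sup>2" by (intro power_mono) auto
      then have "1 \<le> 4 * (od' 256 x)\<^sup>2" by (simp add: power_divide)
      moreover have "0 \<le> 256\<^sup>2 * x\<^sup>2" by simp
      ultimately have "1 - 256\<^sup>2 * x\<^sup>2 \<le> 4 * (od' 256 x)\<^sup>2" by linarith
      moreover have "(od' 256 x)\<^sup>2 > 0" using od'_pos[of 256 x] x by simp
      ultimately have "(1 - 256\<^sup>2 * x\<^sup>2) / (od' 256 x)\<^sup>2 \<le> 4" by (simp only: pos_divide_le_eq)
      then show "- gam 256 x \<le> 4" by (simp add: gam_def minus_divide_left)
    qed (auto intro!: derivative_eq_intros)
    then show ?thesis using y by simp
  qed
  have "eta 256 (1 / 16) - eta 256 (1 / 32) \<le> - 7 * (1 / 16) - - 7 * (1 / 32)"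
  proof (rule deriv_compare[OF _ eta_deriv, where h' = "\<lambda>_. - 7"])
    fix x :: real assume x: "1 / 32 \<le> x" "x \<le> 1 / 16"
    have "x ^ 4 \<le> (1 / 16) ^ 4" using x by (intro power_mono) auto
    then have "256\<^sup>2 * x ^ 4 \<le> 1" by (simp add: power_divide)
    then have "exp (256\<^sup>2 * x ^ 4) \<le> exp 1" by (simp only: exp_le_cancel_iff)
    moreover have "od' 256 x \<le> exp (256\<^sup>2 * x ^ 4)" using x by (intro od'_upper) auto
    ultimately have "od' 256 x \<le> exp 1" by linarith
    then have "od' 256 x \<le> 3" using exp_le by simp
    then have "(od' 256 x)\<^sup>2 \<le> 3\<^sup>2" using od'_pos[of 256 x] x by (intro power_mono) auto
    moreover have "(1 / 32)\<^sup>2 \<le> x\<^sup>2" using x by (intro power_mono) auto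
    then have "63 \<le> 256\<^sup>2 * x\<^sup>2 - 1" by (simp add: power_divide)
    ultimately have "7 * (od' 256 x)\<^sup>2 \<le> 256\<^sup>2 * x\<^sup>2 - 1" by simp
    moreover have "(od' 256 x)\<^sup>2 > 0" using od'_pos[of 256 x] x by simp
    ultimately have "7 \<le> gam 256 x" unfolding gam_def by (simp only: pos_le_divide_eq)
    then show "- gam 256 x \<le> - 7" by simp
  qed (auto intro!: derivative_eq_intros)
  moreover have "eta 256 (1 / 32) \<le> eta 256 (1 / 256)" "eta 256 b \<le> eta 256 (1 / 16)"
    using dec assms by auto
  moreover have "eta 256 s \<le> 1 / 64"
    using core[of s] core[of "1 / 256"] dec[of "1 / 256" s] assms by (cases "s \<le> 1 / 256") auto
  moreover have "eta 256 (1 / 256) \<le> 1 / 64" using core by simp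
  ultimately show ?thesis by simp
qed

lemma eta_jointly_continuous: "continuous_on ({1..\<Gamma>} \<times> {0..Y}) (\<lambda>(g, y). eta g y)"
proof -
  have sub: "{1..\<Gamma>} \<times> {0..Y} \<subseteq> {0..\<Gamma>} \<times> {0..Y}" by auto
  have "continuous_on ({1..\<Gamma>} \<times> {0..Y}) (\<lambda>p. - (case p of (g, y) \<Rightarrow> ev' g y) / (case p of (g, y) \<Rightarrow> od' g y))"
    using od'_pos
    by (intro continuous_intros continuous_on_subset[OF osc_jointly_continuous(2) sub]) force
  then show ?thesis
    by (simp add: eta_def case_prod_beta')
qed

section \<open>Unimodality in the position of the interval\<close>

text \<open>\<open>X\<close> is positive just after \<open>s0\<close>. A first return to zero would
  be reached from positive values, against the positive derivative there.\<close>

lemma pos_after_upcrossing: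
  fixes X :: "real \<Rightarrow> real"
  assumes cont: "continuous_on {s0..s} X" and X0: "X s0 = 0" and s: "s0 < s"
    and up: "\<And>t. s0 \<le> t \<Longrightarrow> t \<le> s \<Longrightarrow> X t = 0 \<Longrightarrow> \<exists>d>0. (X has_real_derivative d) (at t)"
  shows "X s > 0"
proof (rule ccontr)
  assume neg: "\<not> X s > 0"
  obtain d where "d > 0" "(X has_real_derivative d) (at s0)" using up[of s0] s X0 by auto
  then obtain e where e: "e > 0" "\<And>h. 0 < h \<Longrightarrow> h < e \<Longrightarrow> X s0 < X (s0 + h)"
    using DERIV_pos_inc_right by blast
  define p where "p = s0 + min (e / 2) ((s - s0) / 2)"
  have "0 < min (e / 2) ((s - s0) / 2)" "min (e / 2) ((s - s0) / 2) < e"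
    "min (e / 2) ((s - s0) / 2) < s - s0"
    using e(1) s by (auto simp: min_less_iff_disj)
  then have p: "s0 < p" "p < s" "X p > 0" using e(2) X0 unfolding p_def by force+
  define S where "S = {p..s} \<inter> X -` {..0}"
  have cont': "continuous_on {p..s} X" by (rule continuous_on_subset[OF cont]) (use p in auto)
  then have "closed S"
    unfolding S_def by (intro continuous_closed_preimage) auto
  then have "compact S"
    unfolding S_def by (metis bounded_Int bounded_closed_interval box_real(2) compact_eq_bounded_closed)
  moreover have "s \<in> S" using neg p by (auto simp: S_def)
  ultimately obtain t where t: "t \<in> S" "\<And>x. x \<in> S \<Longrightarrow> t \<le> x"
    using compact_attains_inf[of S] by blast
  have t': "p \<le> t" "t \<le> s" "X t \<le> 0" using t(1) by (auto simp: S_def)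
  have "\<exists>x. p \<le> x \<and> x \<le> t \<and> X x = 0"
    by (rule IVT2') (use t' p in \<open>auto intro: continuous_on_subset[OF cont']\<close>)
  then obtain x where x: "p \<le> x" "x \<le> t" "X x = 0" by blast
  then have "t \<le> x" using t(2)[of x] t' by (auto simp: S_def)
  then have Xt: "X t = 0" using x by simp
  then have pt: "p < t" using p(3) t'(1) by (cases "p = t") auto
  obtain d where "d > 0" "(X has_real_derivative d) (at t)" using up[of t] t' p Xt by auto
  then obtain e where e: "e > 0" "\<And>h. 0 < h \<Longrightarrow> h < e \<Longrightarrow> X (t - h) < X t"
    using DERIV_pos_inc_left by blast
  define h where "h = min (e / 2) (t - p)"
  have h: "0 < h" "h < e" "h \<le> t - p" using e(1) pt by (auto simp: h_def min_less_iff_disj)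
  then have "t - h \<in> S" using e(2)[of h] Xt t' by (auto simp: S_def)
  then show False using t(2)[of "t - h"] h by simp
qed

text \<open>The forward statement applied to \<open>- X (- t)\<close>: reflecting and negating
  together preserve the sign of the derivative.\<close>

lemma neg_before_upcrossing:
  fixes X :: "real \<Rightarrow> real"
  assumes cont: "continuous_on {s..s0} X" and X0: "X s0 = 0" and s: "s < s0"
    and up: "\<And>t. s \<le> t \<Longrightarrow> t \<le> s0 \<Longrightarrow> X t = 0 \<Longrightarrow> \<exists>d>0. (X has_real_derivative d) (at t)"
  shows "X s < 0"
proof -
  have "0 < - X (- (- s))"
  proof (rule pos_after_upcrossing[where X = "\<lambda>t. - X (- t)" and ?s0.0 = "- s0" and s = "- s"])
    show "continuous_on {- s0..- s} (\<lambda>t. - X (- t))"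
      by (intro continuous_intros continuous_on_compose2[OF cont]) auto
    fix t assume "- s0 \<le> t" "t \<le> - s" "- X (- t) = 0"
    then obtain d where d: "d > 0" "(X has_real_derivative d) (at (- t))"
      using up[of "- t"] by auto
    then show "\<exists>d>0. ((\<lambda>t. - X (- t)) has_real_derivative d) (at t)"
      using DERIV_minus[OF DERIV_mirror[THEN iffD1, OF d(2)]] by auto
  qed (use X0 s in auto)
  then show ?thesis by simp
qed

text \<open>\<open>256\<close> bounds the admissible \<open>g\<close> (lemma \<open>eta_256_sum_neg\<close>), and \<open>exp (2 ^ 20)\<close> bounds \<open>od' g\<close> on \<open>[0, 2]\<close>.\<close>

definition threshold :: real where
  "threshold = 8192 * 256 ^ 4 * (exp (2 ^ 20))\<^sup>2 + 2"

lemma threshold_ge: "threshold \<ge> 2"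
  by (simp add: threshold_def)

text \<open>Put \<open>b = 2 * D - s\<close>. The common value of \<open>gam\<close> is positive
  because \<open>b\<close> is large, so \<open>s\<close> lies beyond \<open>1 / g\<close>; strict
  decrease of \<open>gam\<close> from \<open>2\<close> on puts \<open>s\<close> below
  \<open>2\<close>. The derivative consists of a term at \<open>s\<close> bounded below
  independently of \<open>D\<close>, a nonnegative term at \<open>b\<close>, and negative terms
  proportional to the common value, which are of order \<open>1 / b ^ 3\<close>.\<close>

lemma gam_difference_upcrossing:
  assumes g: "1 \<le> g" "g \<le> 256" and D: "threshold \<le> D" and s: "0 \<le> s" "s < D"
    and eq: "gam g s = gam g (2 * D - s)"
  shows "\<exists>d>0. ((\<lambda>s. gam g s - gam g (2 * D - s)) has_real_derivative d) (at s)"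
proof -
  define b where "b = 2 * D - s"
  have b: "b \<ge> threshold" "b > s" using s D by (auto simp: b_def)
  then have b2: "b \<ge> 2" using threshold_ge by simp
  define \<gamma> where "\<gamma> = gam g b"
  have \<gamma>s: "gam g s = \<gamma>" using eq by (simp add: \<gamma>_def b_def)
  have "g * b > 1" using mult_mono[of 1 g 2 b] g b2 by simp
  then have \<gamma>0: "\<gamma> > 0" using gam_pos[OF g(1)] b2 by (simp add: \<gamma>_def)
  have s2: "s < 2" using gam_strict_decreasing[OF g(1), of s b] b \<gamma>s by (force simp: \<gamma>_def)
  have gs: "g * s > 1"
  proof (rule ccontr)
    assume "\<not> g * s > 1"
    then have "s \<le> 1 / g" using g by (simp add: field_simps)
    then show False using gam_nonpos[OF g(1) s(1)] \<gamma>s \<gamma>0 by simp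
  qed
  have g2: "g\<^sup>2 \<le> 256\<^sup>2" using g by (intro power_mono) auto
  let ?A = "exp (2 ^ 20) :: real"
  have "od' g s \<le> ?A"
  proof -
    have "s ^ 4 \<le> 2 ^ 4" using s s2 by (intro power_mono) auto
    then have "g\<^sup>2 * s ^ 4 \<le> 256\<^sup>2 * 2 ^ 4" using g2 s by (intro mult_mono) auto
    also have "\<dots> = (2 ^ 20 :: real)" by simp
    finally have "exp (g\<^sup>2 * s ^ 4) \<le> ?A" by simp
    then show ?thesis using od'_upper[OF g(1) s(1)] by linarith
  qed
  then have "(od' g s)\<^sup>2 \<le> ?A\<^sup>2" using od'_pos[OF g(1) s(1)] by (intro power_mono) auto
  moreover have "1 \<le> g\<^sup>2 * s"
    using mult_mono[of 1 g 1 "g * s"] g gs by (simp add: power2_eq_square)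
  moreover have "(od' g s)\<^sup>2 > 0" using od'_pos[OF g(1) s(1)] by simp
  ultimately have main: "1 / ?A\<^sup>2 \<le> g\<^sup>2 * s / (od' g s)\<^sup>2"
    by (intro frac_le) auto
  have ratio: "(g\<^sup>2 * y\<^sup>2 - 1) * od g y / od' g y \<le> 256\<^sup>2 * (4 * b ^ 3)" if y: "0 \<le> y" "y \<le> b" for y
  proof -
    have O: "od g y \<ge> 0" "od' g y > 0" using od_nonneg od'_pos g y by auto
    have y2: "y\<^sup>2 \<le> b\<^sup>2" using y by (intro power_mono) auto
    have "(g\<^sup>2 * y\<^sup>2 - 1) * od g y / od' g y \<le> g\<^sup>2 * y\<^sup>2 * (od g y / od' g y)"
      using O by (simp add: divide_simps algebra_simps)
    also have "\<dots> \<le> (256\<^sup>2 * b\<^sup>2) * (4 * b)"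
    proof (intro mult_mono)
      have "od g y / od' g y \<le> 4 * y" using od_upper[OF g(1) y(1)] O by (simp add: pos_divide_le_eq)
      then show "od g y / od' g y \<le> 4 * b" using y by simp
    qed (use g2 y2 O in auto)
    also have "\<dots> = 256\<^sup>2 * (4 * b ^ 3)" by (simp add: power2_eq_square power3_eq_cube)
    finally show ?thesis .
  qed
  have \<gamma>_small: "\<gamma> \<le> 256\<^sup>2 * 1024 / b ^ 6"
  proof -
    have *: "(b ^ 4 / 32)\<^sup>2 \<le> (od' g b)\<^sup>2" using od'_growth[OF g(1) b2] b2 by (intro power_mono) auto
    have "\<gamma> \<le> (256\<^sup>2 * b\<^sup>2) / (b ^ 4 / 32)\<^sup>2"
    proof -
      have "g\<^sup>2 * b\<^sup>2 - 1 \<le> 256\<^sup>2 * b\<^sup>2"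
        using mult_right_mono[OF g2, of "b\<^sup>2"] by simp
      then show ?thesis
        unfolding \<gamma>_def gam_def using * b2 by (intro frac_le) auto
    qed
    also have "\<dots> = 256\<^sup>2 * 1024 / b ^ 6"
      using b2 by (simp add: power_divide field_simps flip: power_mult power_add)
    finally show ?thesis .
  qed
  \<comment> \<open>The value \<open>\<gamma>\<close> is of order \<open>1 / b ^ 6\<close> and the
    two ratios are of order \<open>b ^ 3\<close>. The product of the constants is the factor
    \<open>8192 * 256 ^ 4\<close> in \<open>threshold\<close>.\<close>
  have "\<gamma> * ((g\<^sup>2 * s\<^sup>2 - 1) * od g s / od' g s + (g\<^sup>2 * b\<^sup>2 - 1) * od g b / od' g b)
      \<le> (256\<^sup>2 * 1024 / b ^ 6) * (256\<^sup>2 * (4 * b ^ 3) + 256\<^sup>2 * (4 * b ^ 3))"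
  proof (intro mult_mono add_mono ratio \<gamma>_small)
    have "0 \<le> (g\<^sup>2 * y\<^sup>2 - 1) * od g y / od' g y" if "1 < g * y" "0 \<le> y" for y
      using sq_prod_ge_1[OF g(1), of y] that g od_nonneg[OF g(1), of y] od'_pos[OF g(1), of y]
      by (intro divide_nonneg_nonneg mult_nonneg_nonneg) (auto simp: divide_le_eq mult.commute)
    then show "0 \<le> (g\<^sup>2 * s\<^sup>2 - 1) * od g s / od' g s + (g\<^sup>2 * b\<^sup>2 - 1) * od g b / od' g b"
      using gs s \<open>g * b > 1\<close> b2 by (intro add_nonneg_nonneg) auto
  qed (use s b b2 in auto)
  also have "\<dots> = 8192 * 256 ^ 4 / b ^ 3"
    using b2 by (simp add: field_simps flip: power_add)
  also have "\<dots> < 1 / ?A\<^sup>2"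
  proof -
    have "8192 * 256 ^ 4 * ?A\<^sup>2 < b" using b unfolding threshold_def by linarith
    also have "b \<le> b ^ 3" using b2 by (intro self_le_power) auto
    finally show ?thesis using b2 by (simp add: field_simps)
  qed
  finally have small: "\<gamma> * ((g\<^sup>2 * s\<^sup>2 - 1) * od g s / od' g s + (g\<^sup>2 * b\<^sup>2 - 1) * od g b / od' g b)
      < 1 / ?A\<^sup>2" .
  let ?d = "\<lambda>y. 2 * g\<^sup>2 * y / (od' g y)\<^sup>2 - 2 * gam g y * ((g\<^sup>2 * y\<^sup>2 - 1) * od g y / od' g y)"
  have "((\<lambda>s. gam g (2 * D - s)) has_real_derivative ?d b * (- 1)) (at s)"
    by (rule DERIV_chain2[where f = "gam g"])
       (use gam_deriv[OF g(1), of b] b2 in \<open>auto simp: b_def intro!: derivative_eq_intros\<close>)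
  from DERIV_diff[OF gam_deriv[OF g(1) s(1)] this]
  have "((\<lambda>s. gam g s - gam g (2 * D - s)) has_real_derivative ?d s + ?d b) (at s)"
    unfolding mult_minus1_right diff_minus_eq_add .
  moreover have "?d s + ?d b > 0"
  proof -
    define R where "R = (\<lambda>y. (g\<^sup>2 * y\<^sup>2 - 1) * od g y / od' g y)"
    define P where "P = (\<lambda>y. g\<^sup>2 * y / (od' g y)\<^sup>2)"
    have "?d s = 2 * P s - 2 * (\<gamma> * R s)" "?d b = 2 * P b - 2 * (\<gamma> * R b)"
      by (simp_all add: R_def P_def \<gamma>s flip: \<gamma>_def)
    moreover have "\<gamma> * R s + \<gamma> * R b < P s"
      using small main unfolding R_def P_def distrib_left[symmetric] by linarith
    moreover have "P b \<ge> 0" using b2 by (simp add: P_def)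
    ultimately show ?thesis by linarith
  qed
  ultimately show ?thesis by blast
qed

section \<open>Critical points of \<open>\<Phi>\<close> as a function of the position\<close>

lemma Phi_deriv:
  assumes "g \<ge> 1" "\<bar>C\<bar> \<le> D"
  shows "((\<lambda>C. eta g (D - C) + eta g (D + C)) has_real_derivative gam g (D - C) - gam g (D + C)) (at C)"
proof -
  have "((\<lambda>C. eta g (D - C)) has_real_derivative - gam g (D - C) * (- 1)) (at C)"
    by (rule DERIV_chain2[where f = "eta g", OF eta_deriv])
       (use assms in \<open>auto intro!: derivative_eq_intros\<close>)
  moreover have "((\<lambda>C. eta g (D + C)) has_real_derivative - gam g (D + C) * 1) (at C)"
    by (rule DERIV_chain2[where f = "eta g", OF eta_deriv])
       (use assms in \<open>auto intro!: derivative_eq_intros\<close>)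
  ultimately show ?thesis using DERIV_add by fastforce
qed

lemma continuous_on_Phi:
  assumes "g \<ge> 1" "S \<subseteq> {- D..D}"
  shows "continuous_on S (\<lambda>C. eta g (D - C) + eta g (D + C))"
proof (rule DERIV_continuous_on)
  fix C assume "C \<in> S"
  then have "\<bar>C\<bar> \<le> D" using assms by (auto simp: abs_le_iff)
  from Phi_deriv[OF assms(1) this]
  show "((\<lambda>C. eta g (D - C) + eta g (D + C)) has_real_derivative gam g (D - C) - gam g (D + C)) (at C within S)"
    by (rule has_field_derivative_at_within)
qed

text \<open>The derivative of \<open>\<Phi>\<close> at \<open>C\<close> is
  \<open>gam g s - gam g (2 * D - s)\<close> with \<open>s = D - C\<close>. As \<open>s\<close>
  falls when \<open>C\<close> grows, upcrossings in \<open>s\<close> are downcrossings in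
  \<open>C\<close>, so the derivative changes sign once, from plus to minus, at
  \<open>C0\<close>.\<close>

lemma Phi_strict_max:
  assumes g: "1 \<le> g" "g \<le> 256" and D: "threshold \<le> D" and C0: "0 < C0" "C0 < D"
    and crit: "gam g (D - C0) = gam g (D + C0)" and C: "0 \<le> C" "C \<le> D" "C \<noteq> C0"
  shows "eta g (D - C) + eta g (D + C) < eta g (D - C0) + eta g (D + C0)"
proof -
  let ?X = "\<lambda>s. gam g s - gam g (2 * D - s)"
  have cont: "continuous_on S ?X" if "S \<subseteq> {0..D}" for S
    by (intro continuous_intros continuous_on_compose2[OF continuous_on_gam[OF g(1) order_refl]]
        continuous_on_gam g) (use that C0 in auto)
  have X0: "?X (D - C0) = 0" using crit by (simp add: algebra_simps)
  have up: "\<exists>d>0. (?X has_real_derivative d) (at t)" if "0 \<le> t" "t < D" "?X t = 0" for t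
    using gam_difference_upcrossing[OF g D that(1,2)] that(3) by simp
  show ?thesis
  proof (cases "C < C0")
    case True
    show ?thesis
    proof (rule DERIV_pos_imp_increasing_open[OF True])
      fix x assume x: "C < x" "x < C0"
      have "?X (D - x) > 0"
        by (rule pos_after_upcrossing[OF cont X0]) (use x C C0 up in auto)
      then show "\<exists>d. ((\<lambda>C. eta g (D - C) + eta g (D + C)) has_real_derivative d) (at x) \<and> d > 0"
        using Phi_deriv[OF g(1), of x D] x C C0 by (auto simp: algebra_simps)
    qed (use continuous_on_Phi[OF g(1)] C C0 in auto)
  next
    case False
    then have "C0 < C" using C by simp
    then show ?thesis
    proof (rule DERIV_neg_imp_decreasing_open)
      fix x assume x: "C0 < x" "x < C"
      have "?X (D - x) < 0"
        by (rule neg_before_upcrossing[OF cont X0]) (use x C C0 up in auto)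
      then show "\<exists>d. ((\<lambda>C. eta g (D - C) + eta g (D + C)) has_real_derivative d) (at x) \<and> d < 0"
        using Phi_deriv[OF g(1), of x D] x C C0 by (auto simp: algebra_simps)
    qed (use continuous_on_Phi[OF g(1)] C C0 in auto)
  qed
qed

text \<open>By symmetry \<open>C = 0\<close> is a critical point of \<open>\<Phi>\<close> and has to
  be excluded as a maximum. For \<open>0 < C < D - 2\<close> both \<open>D - C\<close> and
  \<open>D + C\<close> exceed \<open>2\<close>, where \<open>gam\<close> decreases, so
  \<open>\<Phi>\<close> increases there.\<close>

lemma Phi_not_max_at_0:
  assumes g: "1 \<le> g" and D: "2 < D"
  shows "eta g D + eta g D < eta g 2 + eta g (2 * D - 2)"
proof -
  have "eta g (D - 0) + eta g (D + 0) < eta g (D - (D - 2)) + eta g (D + (D - 2))"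
  proof (rule DERIV_pos_imp_increasing_open[where f = "\<lambda>C. eta g (D - C) + eta g (D + C)" and a = 0])
    fix x assume "0 < x" "x < D - 2"
    then show "\<exists>d. ((\<lambda>C. eta g (D - C) + eta g (D + C)) has_real_derivative d) (at x) \<and> d > 0"
      using Phi_deriv[OF g, of x D] gam_strict_decreasing[OF g, of "D - x" "D + x"] by auto
  qed (use continuous_on_Phi[OF g] D in auto)
  then show ?thesis by simp
qed

text \<open>The witness \<open>g\<close> is the largest one for which \<open>\<Phi>\<^sub>g\<close> takes a nonnegative value on \<open>[0, D]\<close>.\<close>

lemma ex_critical_zero:
  assumes D: "threshold \<le> D"
  shows "\<exists>g C. 1 < g \<and> g < 256 \<and> 0 < C \<and> C < D \<and> eta g (D - C) + eta g (D + C) = 0 \<and>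
           gam g (D - C) = gam g (D + C)"
proof -
  have D2: "D \<ge> 2" using D threshold_ge by simp
  define \<Phi> where "\<Phi> = (\<lambda>g C. eta g (D - C) + eta g (D + C))"
  have cont: "continuous_on ({1..256} \<times> {0..D}) (\<lambda>(g, C). \<Phi> g C)"
  proof -
    have *: "continuous_on ({1..256} \<times> {0..D}) (\<lambda>p. eta (fst p) (f (snd p)))"
      if "f ` {0..D} \<subseteq> {0..2 * D}" "continuous_on {0..D} f" for f
    proof -
      have "continuous_on ({1..256} \<times> {0..D}) (\<lambda>p. (\<lambda>(g, y). eta g y) (fst p, f (snd p)))"
        by (rule continuous_on_compose2[OF eta_jointly_continuous[of 256 "2 * D"]])
           (use that in \<open>auto intro!: continuous_intros intro: continuous_on_compose2[OF that(2)]\<close>)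
      then show ?thesis by simp
    qed
    have "continuous_on ({1..256} \<times> {0..D}) (\<lambda>p. eta (fst p) (D - snd p) + eta (fst p) (D + snd p))"
      by (intro continuous_on_add *[of "\<lambda>C. D - C"] *[of "\<lambda>C. D + C"] continuous_intros) auto
    then show ?thesis by (simp add: \<Phi>_def case_prod_beta')
  qed
  define P where "P = ({1..256} \<times> {0..D}) \<inter> (\<lambda>(g, C). \<Phi> g C) -` {0..}"
  have "closed P"
    unfolding P_def by (intro continuous_closed_preimage cont closed_Times) auto
  then have "compact P"
    unfolding P_def
    by (metis bounded_Int bounded_closed_interval bounded_Times box_real(2) compact_eq_bounded_closed)
  moreover have \<Phi>1: "\<Phi> 1 C > 0" if "0 \<le> C" "C \<le> D" for C
  proof -
    have "eta 1 (D + C) > 0" using eta_1_pos that D2 by simp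
    moreover have "eta 1 (D - C) \<ge> 0"
      using eta_1_pos[of "D - C"] that by (cases "C = D") auto
    ultimately show ?thesis by (simp add: \<Phi>_def)
  qed
  \<comment> \<open>At \<open>g = 1\<close> all values of \<open>\<Phi>\<close> are positive, so
    \<open>P\<close> is nonempty, and compactness yields a pair with the largest
    \<open>g\<close>.\<close>
  then have "(1, 0) \<in> P" using D2 by (auto simp: P_def intro: less_imp_le)
  ultimately obtain p where p: "p \<in> P" "\<And>q. q \<in> P \<Longrightarrow> fst q \<le> fst p"
    using continuous_attains_sup[of P fst] continuous_on_fst[OF continuous_on_id] by (metis empty_iff)
  obtain g C where gC: "p = (g, C)" by (cases p)
  have g: "1 \<le> g" "g \<le> 256" and C: "0 \<le> C" "C \<le> D" and pos: "\<Phi> g C \<ge> 0"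
    using p(1) by (auto simp: P_def gC)
  have g256: "g < 256"
    using eta_256_sum_neg[of "D - C" "D + C"] pos C D2 g by (cases "g = 256") (auto simp: \<Phi>_def)
  \<comment> \<open>A positive value, together with the negative one at \<open>256\<close>, would
    give a zero at some larger parameter by continuity, against the maximality of
    \<open>g\<close>.\<close>
  have max: "\<Phi> g C' \<le> 0" if C': "0 \<le> C'" "C' \<le> D" for C'
  proof (rule ccontr)
    assume "\<not> \<Phi> g C' \<le> 0"
    have "continuous_on {g..256} (\<lambda>g. (\<lambda>(g, C). \<Phi> g C) (g, C'))"
      by (rule continuous_on_compose2[OF cont]) (use C' g in \<open>auto intro!: continuous_intros\<close>)
    then have "\<exists>x. g \<le> x \<and> x \<le> 256 \<and> \<Phi> x C' = 0"
      using \<open>\<not> \<Phi> g C' \<le> 0\<close> eta_256_sum_neg[of "D - C'" "D + C'"] C' D2 g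
      by (intro IVT2') (auto simp: \<Phi>_def)
    then obtain x where x: "g \<le> x" "x \<le> 256" "\<Phi> x C' = 0" by blast
    then have "x \<le> g" using p(2)[of "(x, C')"] C' g by (auto simp: P_def gC)
    then show False using x \<open>\<not> \<Phi> g C' \<le> 0\<close> by simp
  qed
  then have zero: "\<Phi> g C = 0" using pos C by force
  have g1: "1 < g" using \<Phi>1[OF C] zero g by (cases "g = 1") auto
  have D2': "D > 2" using D by (simp add: threshold_def) (smt (verit) exp_gt_zero zero_less_power)
  have "C \<noteq> 0"
    using Phi_not_max_at_0[OF g(1) D2'] zero max[of "D - 2"] D2 by (auto simp: \<Phi>_def)
  have \<Phi>': "(\<Phi> g has_real_derivative gam g (D - C) - gam g (D + C)) (at C)"
    unfolding \<Phi>_def using Phi_deriv[OF g(1)] C by simp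
  \<comment> \<open>At \<open>C = D\<close> the left argument is \<open>0\<close>, where
    \<open>gam\<close> is nonpositive, while \<open>gam g (2 * D)\<close> is positive. So
    \<open>\<Phi> g\<close> would have a negative derivative at its zero \<open>D\<close> and be
    positive just to the left.\<close>
  have "C \<noteq> D"
  proof
    assume "C = D"
    have "gam g 0 \<le> 0" using gam_nonpos[OF g(1), of 0] g by simp
    moreover have "gam g (2 * D) > 0"
      using gam_pos[OF g(1), of "2 * D"] mult_mono[of 1 g 2 "2 * D"] g D2 by simp
    ultimately have "gam g (D - C) - gam g (D + C) < 0" using \<open>C = D\<close> by simp
    from DERIV_neg_dec_left[OF \<Phi>' this] obtain e where
      e: "e > 0" "\<And>h. 0 < h \<Longrightarrow> h < e \<Longrightarrow> \<Phi> g C < \<Phi> g (C - h)" by blast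
    define h where "h = min (e / 2) D"
    have "0 < h" "h < e" "h \<le> D" using e D2 by (auto simp: h_def min_less_iff_disj)
    then show False using e(2)[of h] zero max[of "C - h"] C \<open>C = D\<close> by simp
  qed
  have C': "0 < C" "C < D" using C \<open>C \<noteq> 0\<close> \<open>C \<noteq> D\<close> by auto
  have "gam g (D - C) - gam g (D + C) = 0"
    by (rule DERIV_local_max[OF \<Phi>', of "min C (D - C)"]) (use C' max zero in \<open>auto simp: abs_less_iff\<close>)
  then show ?thesis using g1 g256 C' zero by (auto simp: \<Phi>_def)
qed

section \<open>Positive Neumann solutions\<close>

definition neumann_sol :: "real \<Rightarrow> real \<Rightarrow> real \<Rightarrow> (real \<Rightarrow> real) \<Rightarrow> (real \<Rightarrow> real) \<Rightarrow> bool" where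
  "neumann_sol g a b u v \<longleftrightarrow> ode_sol g a b u v \<and> v a = 0 \<and> v b = 0 \<and> (\<forall>x\<in>{a..b}. u x > 0)"

lemma neumann_sol_reflect:
  assumes "neumann_sol g a b u v"
  shows "neumann_sol g (- b) (- a) (\<lambda>x. u (- x)) (\<lambda>x. - v (- x))"
  using assms ode_sol_reflect[of g a b u v] by (auto simp: neumann_sol_def)

lemma neumann_sol_scale:
  assumes "neumann_sol g a b u v" "k > 0"
  shows "neumann_sol g a b (\<lambda>x. k * u x) (\<lambda>x. k * v x)"
  using assms ode_sol_combine[of g a b u v u v k 0] by (auto simp: neumann_sol_def)

text \<open>For \<open>g1 < g2\<close> the Wronskian of the two positive solutions would increase
  strictly across the interval, yet the Neumann conditions make it vanish at both ends.\<close>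

lemma neumann_g_le:
  assumes 1: "neumann_sol g1 a b u1 v1" and 2: "neumann_sol g2 a b u2 v2"
    and ab: "a < b" and g: "0 < g1" "0 < g2"
  shows "g2 \<le> g1"
proof (rule ccontr)
  assume "\<not> g2 \<le> g1"
  then have sq: "g1\<^sup>2 < g2\<^sup>2" using g by (intro power_strict_mono) auto
  let ?W = "\<lambda>x. u1 x * v2 x - v1 x * u2 x"
  have s: "ode_sol g1 a b u1 v1" "ode_sol g2 a b u2 v2"
    and pos: "\<And>x. x \<in> {a..b} \<Longrightarrow> u1 x > 0 \<and> u2 x > 0"
    using 1 2 by (auto simp: neumann_sol_def)
  have W: "(?W has_real_derivative (g2\<^sup>2 - g1\<^sup>2) * x\<^sup>2 * u1 x * u2 x) (at x)" if "a < x" "x < b" for x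
    using wronskian_deriv[OF s, of x] that by (simp add: at_within_Icc_at)
  have cont: "continuous_on {a..b} ?W"
    by (rule DERIV_continuous_on[OF wronskian_deriv[OF s]])
  \<comment> \<open>The factor \<open>x\<^sup>2\<close> vanishes at \<open>0\<close>, so strict
    monotonicity is obtained on each side of \<open>0\<close> separately.\<close>
  have strict: "?W p < ?W q" if "a \<le> p" "p < q" "q \<le> b" "0 \<le> p \<or> q \<le> 0" for p q
  proof (rule DERIV_pos_imp_increasing_open[OF that(2)])
    fix x assume "p < x" "x < q"
    then have "a < x" "x < b" "x \<noteq> 0" using that by auto
    moreover from this have "(g2\<^sup>2 - g1\<^sup>2) * x\<^sup>2 * u1 x * u2 x > 0"
      using pos[of x] sq by simp
    ultimately show "\<exists>d. (?W has_real_derivative d) (at x) \<and> d > 0" using W by blast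
  qed (rule continuous_on_subset[OF cont], use that in auto)
  have "?W a < ?W b"
    using strict[of a b] strict[of a 0] strict[of 0 b] ab by linarith
  then show False using 1 2 by (simp add: neumann_sol_def)
qed

lemma neumann_g_unique:
  assumes "neumann_sol g1 a b u1 v1" "neumann_sol g2 a b u2 v2" "a < b" "0 < g1" "0 < g2"
  shows "g1 = g2"
  using neumann_g_le[OF assms] neumann_g_le[OF assms(2,1,3,5,4)] by simp

text \<open>Comparison with the Gaussian \<open>exp (- x\<^sup>2 / 2)\<close>, which solves the equation for \<open>g = 1\<close>.\<close>

lemma neumann_g_gt_1:
  assumes n: "neumann_sol g a b u v" and ab: "a < 0" "0 < b" and g: "0 < g"
  shows "1 < g"
proof (rule ccontr)
  assume "\<not> 1 < g"
  then have sq: "g\<^sup>2 \<le> 1" using g by (simp add: power_le_one)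
  let ?e = "\<lambda>x::real. exp (- (x\<^sup>2 / 2))" and ?e' = "\<lambda>x::real. - x * exp (- (x\<^sup>2 / 2))"
  have s: "ode_sol g a b u v" "ode_sol 1 a b ?e ?e'"
    using n unfolding neumann_sol_def ode_sol_def
    by (auto intro!: derivative_eq_intros simp: field_simps power2_eq_square)
  let ?W = "\<lambda>x. u x * ?e' x - v x * ?e x"
  have "?W a \<le> ?W b"
  proof (rule DERIV_nonneg_imp_increasing_open[where f = ?W])
    show "continuous_on {a..b} ?W"
      by (rule DERIV_continuous_on[OF wronskian_deriv[OF s]])
    fix x assume x: "a < x" "x < b"
    then have "u x > 0" using n by (auto simp: neumann_sol_def)
    then have "(1\<^sup>2 - g\<^sup>2) * x\<^sup>2 * u x * ?e x \<ge> 0" using sq by simp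
    then show "\<exists>d. (?W has_real_derivative d) (at x) \<and> d \<ge> 0"
      using wronskian_deriv[OF s, of x] x by (auto simp: at_within_Icc_at)
  qed (use ab in auto)
  moreover have "u a > 0" "u b > 0" "v a = 0" "v b = 0" using n ab by (auto simp: neumann_sol_def)
  moreover from this have "?W a > 0" "?W b < 0"
    using ab by (auto simp: mult_neg_pos mult_pos_neg)
  ultimately show False by linarith
qed

text \<open>Wronskians with \<open>ev\<close> and \<open>od\<close> express the end values of
  \<open>u\<close> through \<open>u 0\<close> and \<open>v 0\<close>. The ratio
  \<open>v 0 / u 0\<close> appears as \<open>eta g b\<close> from the right end and as
  \<open>- eta g s\<close> from the left; each boundary term becomes \<open>gam\<close> times
  \<open>(u 0)\<^sup>2\<close>.\<close>

lemma neumann_sol_eta: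
  assumes n: "neumann_sol g (- s) b u v" and g: "1 \<le> g" and sb: "0 \<le> s" "0 \<le> b"
  shows "eta g s + eta g b = 0"
    and "(g\<^sup>2 * b\<^sup>2 - 1) * (u b)\<^sup>2 = (g\<^sup>2 * (- s)\<^sup>2 - 1) * (u (- s))\<^sup>2 \<longleftrightarrow> gam g s = gam g b"
proof -
  have sol: "ode_sol g (- s) b u v" and bc: "v (- s) = 0" "v b = 0" and u0: "u 0 > 0"
    using n sb by (auto simp: neumann_sol_def)
  note W = wronskian_constant[OF sol ode_sol_osc, of _ 0]
  have pos: "od' g s > 0" "od' g b > 0" using od'_pos[OF g] sb by auto
  have ev: "u b * ev' g b = - v 0" "u (- s) * ev' g s = v 0"
    using W[of b 1 0] W[of "- s" 1 0] bc sb g ev'_minus[of g s] by auto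
  have od: "u b * od' g b = u 0" "u (- s) * od' g s = u 0"
    using W[of b 0 1] W[of "- s" 0 1] bc sb g od'_minus[of g s] by auto
  have ub: "u b = u 0 / od' g b" "u (- s) = u 0 / od' g s"
    using od pos by (auto simp: field_simps)
  have "u 0 * eta g b = v 0" "u 0 * eta g s = - v 0"
    using ev unfolding ub eta_def by auto
  then have "u 0 * (eta g s + eta g b) = 0" by (simp add: distrib_left)
  then show "eta g s + eta g b = 0" using u0 by simp
  show "(g\<^sup>2 * b\<^sup>2 - 1) * (u b)\<^sup>2 = (g\<^sup>2 * (- s)\<^sup>2 - 1) * (u (- s))\<^sup>2 \<longleftrightarrow> gam g s = gam g b"
  proof -
    have "(g\<^sup>2 * b\<^sup>2 - 1) * (u b)\<^sup>2 = gam g b * (u 0)\<^sup>2" "(g\<^sup>2 * (- s)\<^sup>2 - 1) * (u (- s))\<^sup>2 = gam g s * (u 0)\<^sup>2"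
      by (auto simp: ub gam_def power_divide)
    then show ?thesis using u0 by auto
  qed
qed

text \<open>The solution with value \<open>1\<close> and slope \<open>eta g b\<close> at
  \<open>0\<close> has zero slope at \<open>b\<close>. By parity and the hypothesis, its reflection
  is the one with zero slope at \<open>s\<close>, so \<open>shooting_solution_pos\<close> gives
  positivity on each half.\<close>

lemma neumann_sol_of_eta:
  assumes g: "1 \<le> g" and sb: "0 \<le> s" "0 \<le> b" and eq: "eta g s + eta g b = 0"
  shows "\<exists>u v. neumann_sol g (- s) b u v"
proof -
  let ?u = "\<lambda>x. 1 * ev g x + eta g b * od g x" and ?v = "\<lambda>x. 1 * ev' g x + eta g b * od' g x"
  have eb: "eta g b = - eta g s" using eq by simp
  have "ode_sol g (- s) b ?u ?v"
    by (intro ode_sol_combine ode_sol_osc)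
  moreover have "?v b = 0"
    using od'_pos[OF g sb(2)] by (simp add: eta_def)
  moreover have "?v (- s) = 0"
    using od'_pos[OF g sb(1)] ev'_minus[of g s] od'_minus[of g s] g sb
    unfolding eb by (simp add: eta_def)
  moreover have "?u x > 0" if x: "x \<in> {- s..b}" for x
  proof (cases "x \<ge> 0")
    case True
    then show ?thesis using shooting_solution_pos[OF g, of x b] x by simp
  next
    case False
    then show ?thesis
      using shooting_solution_pos[OF g, of "- x" s] ev_minus[of g "- x"] od_minus[of g "- x"] x g
      unfolding eb by simp
  qed
  ultimately show ?thesis unfolding neumann_sol_def by blast
qed

text \<open>The function \<open>(g\<^sup>2 x\<^sup>2 - 1) u\<^sup>2 - v\<^sup>2\<close> has
  derivative \<open>2 g\<^sup>2 x u\<^sup>2\<close>, positive inside the interval. This excludes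
  zeros of \<open>I\<close> when the interval does not reach below \<open>0\<close>.\<close>

lemma neumann_sol_nonneg_interval:
  assumes n: "neumann_sol g a b u v" and ab: "0 \<le> a" "a < b" and g: "0 < g"
  shows "(g\<^sup>2 * a\<^sup>2 - 1) * (u a)\<^sup>2 < (g\<^sup>2 * b\<^sup>2 - 1) * (u b)\<^sup>2"
proof -
  have sol: "ode_sol g a b u v" and bc: "v a = 0" "v b = 0" using n by (auto simp: neumann_sol_def)
  let ?H = "\<lambda>x. (g\<^sup>2 * x\<^sup>2 - 1) * (u x)\<^sup>2 - (v x)\<^sup>2"
  have H: "(?H has_real_derivative 2 * g\<^sup>2 * x * (u x)\<^sup>2) (at x within {a..b})" if "x \<in> {a..b}" for x
    by (rule derivative_eq_intros ode_solD[OF sol that] refl)+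
       (simp add: algebra_simps power2_eq_square)
  have "?H a < ?H b"
  proof (rule DERIV_pos_imp_increasing_open[OF ab(2)])
    show "continuous_on {a..b} ?H" by (rule DERIV_continuous_on[OF H])
    fix x assume x: "a < x" "x < b"
    then have "u x > 0" using n by (auto simp: neumann_sol_def)
    then have "2 * g\<^sup>2 * x * (u x)\<^sup>2 > 0" using g x ab by simp
    then show "\<exists>d. (?H has_real_derivative d) (at x) \<and> d > 0"
      using H[of x] x by (auto simp: at_within_Icc_at)
  qed
  then show ?thesis using bc by simp
qed

section \<open>Existence of positive Neumann solutions\<close>

lemma eta_continuous_in_g:
  assumes "0 \<le> y"
  shows "continuous_on {1..\<Gamma>} (\<lambda>g. eta g y)"
proof -
  have "continuous_on {1..\<Gamma>} (\<lambda>g. (\<lambda>(g, y). eta g y) (g, y))"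
    by (rule continuous_on_compose2[OF eta_jointly_continuous[of \<Gamma> y]])
       (use assms in \<open>auto intro!: continuous_intros\<close>)
  then show ?thesis by simp
qed

lemma osc_continuous_in_g:
  assumes "0 \<le> y"
  shows "continuous_on {0..\<Gamma>} (\<lambda>g. osc g A B y)" "continuous_on {0..\<Gamma>} (\<lambda>g. osc' g A B y)"
proof -
  have "continuous_on {0..\<Gamma>} (\<lambda>g. (\<lambda>(g, y). osc g A B y) (g, y))"
    "continuous_on {0..\<Gamma>} (\<lambda>g. (\<lambda>(g, y). osc' g A B y) (g, y))"
    by (rule continuous_on_compose2[OF osc_jointly_continuous(1)[of \<Gamma> y]]
             continuous_on_compose2[OF osc_jointly_continuous(2)[of \<Gamma> y]];
        use assms in \<open>auto intro!: continuous_intros\<close>)+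
  then show "continuous_on {0..\<Gamma>} (\<lambda>g. osc g A B y)" "continuous_on {0..\<Gamma>} (\<lambda>g. osc' g A B y)"
    by simp_all
qed

text \<open>Intermediate value theorem in \<open>g\<close>: the sum of the two slopes is positive at
  \<open>g = 1\<close> and negative at \<open>g = 256\<close>.\<close>

lemma neumann_sol_exists_around_0:
  assumes C: "0 \<le> C" "C \<le> D" and D: "1 \<le> D"
  shows "\<exists>g u v. 1 \<le> g \<and> neumann_sol g (C - D) (C + D) u v"
proof -
  have "\<exists>g. 1 \<le> g \<and> g \<le> 256 \<and> eta g (D - C) + eta g (D + C) = 0"
  proof (rule IVT2')
    show "eta 256 (D - C) + eta 256 (D + C) \<le> 0"
      using eta_256_sum_neg[of "D - C" "D + C"] assms by simp
    show "0 \<le> eta 1 (D - C) + eta 1 (D + C)"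
      using eta_1_pos[of "D - C"] eta_1_pos[of "D + C"] assms by (cases "C = D") auto
    show "continuous_on {1..256} (\<lambda>g. eta g (D - C) + eta g (D + C))"
      using assms by (intro continuous_on_add eta_continuous_in_g) auto
  qed simp
  then obtain g where g: "1 \<le> g" "eta g (D - C) + eta g (D + C) = 0" by blast
  then show ?thesis
    using neumann_sol_of_eta[of g "D - C" "D + C"] assms by (auto simp: add.commute)
qed

text \<open>Shooting from \<open>a\<close>: the least \<open>g\<close> whose solution stays nonnegative and has nonnegative slope at \<open>b\<close>.\<close>

lemma neumann_sol_exists_positive:
  assumes ab: "0 < a" "a < b"
  shows "\<exists>g u v. 0 < g \<and> neumann_sol g a b u v"
proof -
  \<comment> \<open>With these coefficients the slope at \<open>a\<close> cancels and the value
    there is the Wronskian of \<open>ev\<close> and \<open>od\<close>, which is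
    \<open>1\<close>.\<close>
  define u where "u = (\<lambda>g x. od' g a * ev g x + - ev' g a * od g x)"
  define v where "v = (\<lambda>g x. od' g a * ev' g x + - ev' g a * od' g x)"
  have sol: "ode_sol g a b (u g) (v g)" for g
    unfolding u_def v_def by (intro ode_sol_combine ode_sol_osc)
  have ua [simp]: "u g a = 1" and va [simp]: "v g a = 0" for g
    using wronskian_ev_od[of g a] by (auto simp: u_def v_def algebra_simps)
  have du: "(u g has_real_derivative v g x) (at x)" for g x
    unfolding u_def v_def by (intro DERIV_add DERIV_cmult osc_derivs)
  have dv: "(v g has_real_derivative (g\<^sup>2 * x\<^sup>2 - 1) * u g x) (at x)" for g x
    unfolding u_def v_def by (rule derivative_eq_intros osc_derivs refl)+ (simp add: algebra_simps)
  \<comment> \<open>For this parameter the potential is nonnegative on \<open>[a, b]\<close>, so a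
    solution starting flat at \<open>1\<close> does not decrease; hence \<open>\<Gamma>\<close> lies
    in \<open>T\<close>.\<close>
  define \<Gamma> where "\<Gamma> = 1 / a"
  have \<Gamma>: "\<Gamma> > 0" using ab by (simp add: \<Gamma>_def)
  have cont: "continuous_on {0..\<Gamma>} (\<lambda>g. u g x)" "continuous_on {0..\<Gamma>} (\<lambda>g. v g x)" if "x \<ge> a" for x
    unfolding u_def v_def using that ab
    by (intro continuous_intros osc_continuous_in_g; simp)+
  define T where "T = ({0..\<Gamma>} \<inter> (\<lambda>g. v g b) -` {0..}) \<inter> (\<Inter>x\<in>{a..b}. {0..\<Gamma>} \<inter> (\<lambda>g. u g x) -` {0..})"
  have T_iff: "g \<in> T \<longleftrightarrow> 0 \<le> g \<and> g \<le> \<Gamma> \<and> v g b \<ge> 0 \<and> (\<forall>x\<in>{a..b}. u g x \<ge> 0)" for g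
    using ab by (auto simp: T_def)
  have "closed T"
    unfolding T_def using cont ab by (intro closed_Int closed_INT ballI continuous_closed_preimage) auto
  moreover have "bounded T"
    by (rule bounded_subset[OF bounded_closed_interval[of 0 \<Gamma>]]) (auto simp: T_def)
  ultimately have "compact T" by (simp add: compact_eq_bounded_closed)
  have \<Gamma>T: "\<Gamma> \<in> T"
  proof -
    have Q: "\<Gamma>\<^sup>2 * x\<^sup>2 - 1 \<ge> 0" if "a \<le> x" for x
    proof -
      have "1 \<le> \<Gamma> * x" using that ab by (simp add: \<Gamma>_def)
      then have "1 \<le> (\<Gamma> * x)\<^sup>2" by (simp add: one_le_power)
      then show ?thesis by (simp add: power_mult_distrib)
    qed
    have v0: "v \<Gamma> x \<ge> 0" if "a \<le> x" "\<And>y. a \<le> y \<Longrightarrow> y \<le> x \<Longrightarrow> u \<Gamma> y \<ge> 0" for x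
      using deriv_compare[of a x "\<lambda>_. 0" "\<lambda>_. 0" "v \<Gamma>" "\<lambda>x. (\<Gamma>\<^sup>2 * x\<^sup>2 - 1) * u \<Gamma> x", OF that(1) _ dv] Q that(2)
      by simp
    have u1: "u \<Gamma> x > 1 / 2" if "a \<le> x" for x
    proof -
      have "u \<Gamma> (a + (x - a)) > 1 / 2"
      proof (rule real_bootstrap[where f = "\<lambda>t. u \<Gamma> (a + t)"])
        show "continuous_on {0..x - a} (\<lambda>t. u \<Gamma> (a + t))"
          unfolding u_def by (intro continuous_intros)
        fix t assume t: "0 \<le> t" "\<forall>s\<in>{0..t}. u \<Gamma> (a + s) \<ge> 1 / 2"
        have nn: "u \<Gamma> y \<ge> 0" if "a \<le> y" "y \<le> a + t" for y
          using t(2)[rule_format, of "y - a"] that by simp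
        have "0 - 0 \<le> u \<Gamma> (a + t) - u \<Gamma> a"
          by (rule deriv_compare[where f = "\<lambda>_. 0" and f' = "\<lambda>_. 0", OF _ _ du]) (use t(1) v0 nn in auto)
        then show "u \<Gamma> (a + t) > 1 / 2" by simp
      qed (use that in auto)
      then show ?thesis by simp
    qed
    have "u \<Gamma> x \<ge> 0" if "a \<le> x" for x using u1[OF that] by simp
    then show ?thesis using v0[of b] \<Gamma> ab by (auto simp: T_iff)
  qed
  with \<open>compact T\<close> obtain g where g: "g \<in> T" "\<And>t. t \<in> T \<Longrightarrow> g \<le> t"
    using compact_attains_inf[of T] by blast
  have gT: "0 \<le> g" "g \<le> \<Gamma>" "v g b \<ge> 0" "\<And>x. x \<in> {a..b} \<Longrightarrow> u g x \<ge> 0" using g(1) by (auto simp: T_iff)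
  \<comment> \<open>At a zero of a nonnegative solution the slope vanishes too; at \<open>b\<close>
    this uses \<open>v g b \<ge> 0\<close>. A double zero makes the Wronskians with
    \<open>ev\<close> and \<open>od\<close> vanish, and then \<open>ev' g a\<close> and
    \<open>od' g a\<close> are both \<open>0\<close>.\<close>
  have pos: "u g x > 0" if x: "x \<in> {a..b}" for x
  proof (rule ccontr)
    assume "\<not> u g x > 0"
    then have ux: "u g x = 0" using gT(4)[OF x] by simp
    then have ax: "a < x" using x by (cases "x = a") auto
    have "\<not> v g x > 0"
    proof
      assume "v g x > 0"
      from DERIV_pos_inc_left[OF du this] obtain e
        where e: "e > 0" "\<And>h. 0 < h \<Longrightarrow> h < e \<Longrightarrow> u g (x - h) < u g x" by blast
      define h where "h = min (e / 2) (x - a)"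
      have "0 < h" "h < e" "h \<le> x - a" using e ax by (auto simp: h_def min_less_iff_disj)
      then show False using e(2)[of h] gT(4)[of "x - h"] ux x by simp
    qed
    moreover have "\<not> v g x < 0"
    proof
      assume neg: "v g x < 0"
      then have xb: "x < b" using gT(3) x by (cases "x = b") auto
      from DERIV_neg_dec_right[OF du neg] obtain e
        where e: "e > 0" "\<And>h. 0 < h \<Longrightarrow> h < e \<Longrightarrow> u g x > u g (x + h)" by blast
      define h where "h = min (e / 2) (b - x)"
      have "0 < h" "h < e" "h \<le> b - x" using e xb by (auto simp: h_def min_less_iff_disj)
      then show False using e(2)[of h] gT(4)[of "x + h"] ux x by simp
    qed
    ultimately have "v g x = 0" by simp
    then have "ev' g a = 0" "od' g a = 0"
      using wronskian_constant[OF sol ode_sol_osc[of g a b 1 0], of x a]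
        wronskian_constant[OF sol ode_sol_osc[of g a b 0 1], of x a] ux x by auto
    then show False using wronskian_ev_od[of g a] by simp
  qed
  \<comment> \<open>For \<open>g = 0\<close> the equation is \<open>u'' = - u\<close>, so the slope
    would fall strictly below its value \<open>0\<close> at \<open>a\<close>.\<close>
  have "g \<noteq> 0"
  proof
    assume "g = 0"
    have "v g b < v g a"
    proof (rule DERIV_neg_imp_decreasing[OF ab(2)])
      fix x assume "a \<le> x" "x \<le> b"
      then show "\<exists>d. (v g has_real_derivative d) (at x) \<and> d < 0"
        using dv[of g x] pos[of x] \<open>g = 0\<close> by auto
    qed
    then show False using gT(3) by simp
  qed
  then have g0: "g > 0" using gT by simp
  have "v g b = 0"
  proof (rule ccontr)
    assume "v g b \<noteq> 0"
    then have vb: "v g b > 0" using gT by simp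
    obtain x0 where x0: "x0 \<in> {a..b}" "\<And>x. x \<in> {a..b} \<Longrightarrow> u g x0 \<le> u g x"
      using continuous_attains_inf[of "{a..b}" "u g"] ode_sol_continuous[OF sol] ab by auto
    \<comment> \<open>\<open>\<mu>\<close> is the margin left in both nonnegativity conditions if
      the slope at \<open>b\<close> is positive. By Lipschitz dependence a slightly smaller
      parameter \<open>g - \<delta>\<close> would still lie in \<open>T\<close>, against
      minimality.\<close>
    define \<mu> where "\<mu> = min (u g x0) (v g b)"
    have \<mu>: "\<mu> > 0" using vb pos[OF x0(1)] by (simp add: \<mu>_def)
    obtain M where M: "M \<ge> 0" and dep: "\<And>g' x. 0 \<le> g' \<Longrightarrow> g' \<le> \<Gamma> \<Longrightarrow> x \<in> {a..b} \<Longrightarrow>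
        \<bar>u g' x - u g x\<bar> \<le> M * \<bar>g' - g\<bar> \<and> \<bar>v g' x - v g x\<bar> \<le> M * \<bar>g' - g\<bar>"
      using ode_dependence[OF sol gT(1,2)] sol ua va by metis
    define \<delta> where "\<delta> = min g (\<mu> / (M + 1))"
    have \<delta>: "\<delta> > 0" "\<delta> \<le> g" using \<mu> g0 M by (auto simp: \<delta>_def)
    have "\<delta> \<le> \<mu> / (M + 1)" by (simp add: \<delta>_def)
    then have "\<delta> * (M + 1) \<le> \<mu>" using M by (subst (asm) pos_le_divide_eq) auto
    then have M\<delta>: "M * \<delta> \<le> \<mu>" using \<delta> by (simp add: algebra_simps)
    have d: "\<bar>u (g - \<delta>) x - u g x\<bar> \<le> \<mu> \<and> \<bar>v (g - \<delta>) x - v g x\<bar> \<le> \<mu>" if "x \<in> {a..b}" for x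
      using dep[OF _ _ that, of "g - \<delta>"] \<delta> gT M\<delta> by force
    have "g - \<delta> \<in> T"
      unfolding T_iff
    proof (intro conjI ballI)
      show "v (g - \<delta>) b \<ge> 0" using d[of b] ab by (simp add: \<mu>_def abs_le_iff)
      show "u (g - \<delta>) x \<ge> 0" if "x \<in> {a..b}" for x
        using d[OF that] x0(2)[OF that] by (simp add: \<mu>_def abs_le_iff)
    qed (use \<delta> gT in auto)
    then show False using g(2)[of "g - \<delta>"] \<delta> by simp
  qed
  then have "neumann_sol g a b (u g) (v g)"
    using sol pos by (simp add: neumann_sol_def)
  then show ?thesis using g0 by blast
qed

lemma neumann_sol_exists:
  assumes "0 \<le> C" "1 \<le> D"
  shows "\<exists>g u v. 0 < g \<and> neumann_sol g (C - D) (C + D) u v"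
proof (cases "C \<le> D")
  case True
  then show ?thesis using neumann_sol_exists_around_0[of C D] assms by (meson less_le_trans zero_less_one)
next
  case False
  then show ?thesis using neumann_sol_exists_positive[of "C - D" "C + D"] assms by simp
qed

text \<open>\<open>crit\<close> is the equation \<open>I = 0\<close> in scaled form. It forces
  \<open>0\<close> into the interior of the interval; then \<open>g\<close> lies between
  \<open>1\<close> and \<open>256\<close>, and \<open>C\<close> is the strict maximum of
  \<open>\<Phi>\<close> for this \<open>g\<close>, with value \<open>0\<close>.\<close>

lemma critical_neumann_sol:
  assumes D: "threshold \<le> D" and C: "0 < C" and g: "0 < g"
    and n: "neumann_sol g (C - D) (C + D) u v"
    and crit: "(g\<^sup>2 * (C + D)\<^sup>2 - 1) * (u (C + D))\<^sup>2 = (g\<^sup>2 * (C - D)\<^sup>2 - 1) * (u (C - D))\<^sup>2"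
  shows "C < D"
    and "\<lbrakk>0 \<le> C'; C' < D; C' \<noteq> C; 0 < g'; neumann_sol g' (C' - D) (C' + D) u' v'\<rbrakk> \<Longrightarrow> g' < g"
proof -
  have D2: "D \<ge> 2" using D threshold_ge by simp
  show CD: "C < D"
    using neumann_sol_nonneg_interval[OF n _ _ g] crit D2 by (cases "C < D") auto
  have g1: "1 < g" using neumann_g_gt_1[OF n _ _ g] CD C by simp
  have n': "neumann_sol g (- (D - C)) (D + C) u v" using n by (simp add: add.commute)
  have zero: "eta g (D - C) + eta g (D + C) = 0"
    and gam: "gam g (D - C) = gam g (D + C)"
    using neumann_sol_eta[OF n'] g1 CD C crit by (auto simp: add.commute)
  have g256: "g \<le> 256"
  proof (rule ccontr)
    assume "\<not> g \<le> 256"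
    then have "eta g (D - C) \<le> eta 256 (D - C)" "eta g (D + C) \<le> eta 256 (D + C)"
      using CD C by (auto intro!: eta_antimono)
    then show False using eta_256_sum_neg[of "D - C" "D + C"] zero CD C D2 by simp
  qed
  assume C': "0 \<le> C'" "C' < D" "C' \<noteq> C" and g': "0 < g'" and s': "neumann_sol g' (C' - D) (C' + D) u' v'"
  have g'1: "1 < g'" using neumann_g_gt_1[OF s' _ _ g'] C' by simp
  have "neumann_sol g' (- (D - C')) (D + C') u' v'" using s' by (simp add: add.commute)
  then have zero': "eta g' (D - C') + eta g' (D + C') = 0"
    using neumann_sol_eta(1) g'1 C' by simp
  have neg: "eta g (D - C') + eta g (D + C') < 0"
    using Phi_strict_max[OF _ g256 D C CD gam, of C'] g1 C' zero by simp
  \<comment> \<open>At \<open>C'\<close> the value of \<open>\<Phi>\<close> is negative for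
    \<open>g\<close>, hence for every larger parameter, whereas it is zero for
    \<open>g'\<close>.\<close>
  show "g' < g"
  proof (rule ccontr)
    assume "\<not> g' < g"
    then have "eta g' (D - C') \<le> eta g (D - C')" "eta g' (D + C') \<le> eta g (D + C')"
      using C' g1 by (auto intro!: eta_antimono)
    then show False using neg zero' by simp
  qed
qed

lemma ex_critical_neumann_sol:
  assumes D: "threshold \<le> D"
  shows "\<exists>C g u v. 0 < C \<and> 0 < g \<and> neumann_sol g (C - D) (C + D) u v \<and>
    (g\<^sup>2 * (C + D)\<^sup>2 - 1) * (u (C + D))\<^sup>2 = (g\<^sup>2 * (C - D)\<^sup>2 - 1) * (u (C - D))\<^sup>2"
proof -
  obtain g C where g: "1 < g" and C: "0 < C" "C < D"
    and zero: "eta g (D - C) + eta g (D + C) = 0" and gam: "gam g (D - C) = gam g (D + C)"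
    using ex_critical_zero[OF D] by blast
  obtain u v where n: "neumann_sol g (- (D - C)) (D + C) u v"
    using neumann_sol_of_eta[of g "D - C" "D + C"] zero g C by auto
  from neumann_sol_eta(2)[OF n] g C gam
  have "(g\<^sup>2 * (D + C)\<^sup>2 - 1) * (u (D + C))\<^sup>2 = (g\<^sup>2 * (- (D - C))\<^sup>2 - 1) * (u (- (D - C)))\<^sup>2" by simp
  then show ?thesis using n g C by (intro exI[of _ C] exI[of _ g] exI[of _ u] exI[of _ v]) (simp add: add.commute)
qed

section \<open>The original scaling\<close>

lemma DERIV_affine:
  fixes f :: "real \<Rightarrow> real"
  assumes "(f has_real_derivative f') (at (k * x + l) within T)" "(\<lambda>x. k * x + l) ` S \<subseteq> T"
  shows "((\<lambda>x. f (k * x + l)) has_real_derivative f' * k) (at x within S)"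
proof -
  have "((\<lambda>x. k * x + l) has_real_derivative k) (at x within S)"
    by (auto intro!: derivative_eq_intros)
  from DERIV_image_chain[OF DERIV_subset[OF assms] this] show ?thesis
    by (simp add: o_def)
qed

text \<open>The substitution \<open>y = \<kappa> * (x + c)\<close> with
  \<open>g = h / \<kappa>\<close> removes \<open>c\<close> from the equation and moves it into the
  interval.\<close>

lemma neumann_sol_of_pos_solution:
  assumes p: "pos_solution \<kappa> d c h \<psi>" and \<kappa>: "\<kappa> > 0"
  shows "\<exists>v. neumann_sol (h / \<kappa>) (\<kappa> * c - \<kappa> * d) (\<kappa> * c + \<kappa> * d) (\<lambda>y. \<psi> (y / \<kappa> - c)) v"
proof -
  obtain \<phi> where \<psi>: "\<And>x. x \<in> {-d..d} \<Longrightarrow> (\<psi> has_real_derivative \<phi> x) (at x within {-d..d})"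
    and \<phi>: "\<And>x. x \<in> {-d..d} \<Longrightarrow> (\<phi> has_real_derivative \<kappa>\<^sup>2 * (h\<^sup>2 * (x + c)\<^sup>2 - 1) * \<psi> x)
        (at x within {-d..d})"
    and bc: "\<phi> (-d) = 0" "\<phi> d = 0" and pos: "\<And>x. x \<in> {-d..d} \<Longrightarrow> \<psi> x > 0"
    using p unfolding pos_solution_def by blast
  let ?J = "{\<kappa> * c - \<kappa> * d..\<kappa> * c + \<kappa> * d}"
  have mem: "1 / \<kappa> * y + - c \<in> {-d..d}" if "y \<in> ?J" for y
    using that \<kappa> by (auto simp: field_simps)
  then have sub: "(\<lambda>y. 1 / \<kappa> * y + - c) ` ?J \<subseteq> {-d..d}" by blast
  let ?u = "\<lambda>y. \<psi> (1 / \<kappa> * y + - c)" and ?v = "\<lambda>y. 1 / \<kappa> * \<phi> (1 / \<kappa> * y + - c)"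
  have "ode_sol (h / \<kappa>) (\<kappa> * c - \<kappa> * d) (\<kappa> * c + \<kappa> * d) ?u ?v"
    unfolding ode_sol_def
  proof (intro ballI conjI)
    fix y assume y: "y \<in> ?J"
    show "(?u has_real_derivative ?v y) (at y within ?J)"
      using DERIV_affine[OF \<psi>[OF mem[OF y]] sub] by (simp only: mult.commute)
    have "1 / \<kappa> * ((\<kappa>\<^sup>2 * (h\<^sup>2 * (1 / \<kappa> * y + - c + c)\<^sup>2 - 1) * ?u y) * (1 / \<kappa>))
        = ((h / \<kappa>)\<^sup>2 * y\<^sup>2 - 1) * ?u y"
      using \<kappa> by (simp add: field_simps power2_eq_square)
    then show "(?v has_real_derivative ((h / \<kappa>)\<^sup>2 * y\<^sup>2 - 1) * ?u y) (at y within ?J)"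
      using DERIV_cmult[OF DERIV_affine[OF \<phi>[OF mem[OF y]] sub], of "1 / \<kappa>"] by simp
  qed
  moreover have "?v (\<kappa> * c - \<kappa> * d) = 0" "?v (\<kappa> * c + \<kappa> * d) = 0"
    using bc \<kappa> by (simp_all add: diff_divide_distrib add_divide_distrib)
  moreover have "\<forall>y\<in>?J. ?u y > 0" using pos mem by blast
  ultimately have "neumann_sol (h / \<kappa>) (\<kappa> * c - \<kappa> * d) (\<kappa> * c + \<kappa> * d) ?u ?v"
    by (simp add: neumann_sol_def)
  then show ?thesis by auto
qed

lemma pos_solution_of_neumann_sol:
  assumes n: "neumann_sol g (\<kappa> * c - \<kappa> * d) (\<kappa> * c + \<kappa> * d) u v" and \<kappa>: "\<kappa> > 0"
    and ic: "u (\<kappa> * c - \<kappa> * d) = 1"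
  shows "pos_solution \<kappa> d c (\<kappa> * g) (\<lambda>x. u (\<kappa> * x + \<kappa> * c))"
proof -
  let ?J = "{\<kappa> * c - \<kappa> * d..\<kappa> * c + \<kappa> * d}"
  have sol: "ode_sol g (\<kappa> * c - \<kappa> * d) (\<kappa> * c + \<kappa> * d) u v"
    and bc: "v (\<kappa> * c - \<kappa> * d) = 0" "v (\<kappa> * c + \<kappa> * d) = 0" and pos: "\<And>y. y \<in> ?J \<Longrightarrow> u y > 0"
    using n by (auto simp: neumann_sol_def)
  have mem: "\<kappa> * x + \<kappa> * c \<in> ?J" if "x \<in> {-d..d}" for x
    using that \<kappa> mult_left_mono[of "-d" x \<kappa>] mult_left_mono[of x d \<kappa>] by auto
  then have sub: "(\<lambda>x. \<kappa> * x + \<kappa> * c) ` {-d..d} \<subseteq> ?J" by blast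
  let ?\<psi> = "\<lambda>x. u (\<kappa> * x + \<kappa> * c)" and ?\<phi> = "\<lambda>x. \<kappa> * v (\<kappa> * x + \<kappa> * c)"
  have "(?\<psi> has_real_derivative ?\<phi> x) (at x within {-d..d})" if "x \<in> {-d..d}" for x
    using DERIV_affine[OF ode_solD(1)[OF sol mem[OF that]] sub] by (simp only: mult.commute)
  moreover have "(?\<phi> has_real_derivative \<kappa>\<^sup>2 * ((\<kappa> * g)\<^sup>2 * (x + c)\<^sup>2 - 1) * ?\<psi> x) (at x within {-d..d})"
    if "x \<in> {-d..d}" for x
  proof -
    have eq: "\<kappa> * ((g\<^sup>2 * (\<kappa> * x + \<kappa> * c)\<^sup>2 - 1) * ?\<psi> x * \<kappa>) = \<kappa>\<^sup>2 * ((\<kappa> * g)\<^sup>2 * (x + c)\<^sup>2 - 1) * ?\<psi> x"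
      by (simp add: algebra_simps power2_eq_square)
    show ?thesis
      using DERIV_cmult[OF DERIV_affine[OF ode_solD(2)[OF sol mem[OF that]] sub], of \<kappa>]
      unfolding eq .
  qed
  moreover have "?\<phi> (-d) = 0" "?\<phi> d = 0" "?\<psi> (-d) = 1"
    using bc ic by (simp_all add: add.commute)
  moreover have "\<forall>x\<in>{-d..d}. ?\<psi> x > 0" using pos mem by blast
  ultimately show ?thesis
    unfolding pos_solution_def by (intro conjI exI[of _ ?\<phi>] ballI; blast)
qed

text \<open>Allows a solution to be replaced by its extension by zero, as the definition of
  \<open>psi0\<close> requires.\<close>

lemma pos_solution_cong:
  assumes "pos_solution \<kappa> d c h \<psi>" "\<And>x. x \<in> {-d..d} \<Longrightarrow> \<psi>' x = \<psi> x" "0 \<le> d"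
  shows "pos_solution \<kappa> d c h \<psi>'"
proof -
  have "(\<psi>' has_real_derivative D) (at x within {-d..d})"
    if "(\<psi> has_real_derivative D) (at x within {-d..d})" "x \<in> {-d..d}" for x D
    using has_field_derivative_transform_within[OF that(1) zero_less_one that(2)] assms(2) by metis
  moreover obtain \<phi> where "\<forall>x\<in>{-d..d}. (\<psi> has_real_derivative \<phi> x) (at x within {-d..d})"
    "\<forall>x\<in>{-d..d}. (\<phi> has_real_derivative \<kappa>\<^sup>2 * (h\<^sup>2 * (x + c)\<^sup>2 - 1) * \<psi> x) (at x within {-d..d})"
    "\<phi> (-d) = 0" "\<phi> d = 0" "\<psi> (-d) = 1" "\<forall>x\<in>{-d..d}. \<psi> x > 0"
    using assms(1) unfolding pos_solution_def by blast
  ultimately show ?thesis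
    using assms(2,3) unfolding pos_solution_def by (intro conjI exI[of _ \<phi>] ballI) simp_all
qed

section \<open>The field, the solution and the integral in terms of scaled solutions\<close>

lemma h_field_eq:
  assumes n: "neumann_sol g (\<kappa> * c - \<kappa> * d) (\<kappa> * c + \<kappa> * d) u v" and pos: "\<kappa> > 0" "d > 0" "g > 0"
  shows "h_field \<kappa> d c = \<kappa> * g"
  unfolding h_field_def
proof (rule the_equality)
  let ?a = "\<kappa> * c - \<kappa> * d"
  have "u ?a > 0" using n pos by (auto simp: neumann_sol_def)
  then have "pos_solution \<kappa> d c (\<kappa> * g) (\<lambda>x. 1 / u ?a * u (\<kappa> * x + \<kappa> * c))"
    using pos_solution_of_neumann_sol[OF neumann_sol_scale[OF n, of "1 / u ?a"] pos(1)] by simp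
  then show "0 < \<kappa> * g \<and> (\<exists>\<psi>. pos_solution \<kappa> d c (\<kappa> * g) \<psi>)" using pos by auto
  fix h assume h: "0 < h \<and> (\<exists>\<psi>. pos_solution \<kappa> d c h \<psi>)"
  then obtain u' v' where "neumann_sol (h / \<kappa>) ?a (\<kappa> * c + \<kappa> * d) u' v'"
    using neumann_sol_of_pos_solution[OF _ pos(1)] by blast
  then have "h / \<kappa> = g"
    using neumann_g_unique[OF _ n] h pos by (simp add: add_strict_mono)
  then show "h = \<kappa> * g" using pos by auto
qed

text \<open>Two solutions for the same field have equal value and slope at the left end, so the
  scaled equation identifies them. The definite description may thus be replaced by any solution at
  hand.\<close>

lemma psi0_eq:
  assumes p: "pos_solution \<kappa> d c (h_field \<kappa> d c) \<psi>" and h: "0 < h_field \<kappa> d c"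
    and pos: "\<kappa> > 0" "d > 0" and x: "x \<in> {-d..d}"
  shows "psi0 \<kappa> d c x = \<psi> x"
proof -
  let ?h = "h_field \<kappa> d c"
  have uniq: "\<psi>1 x = \<psi>2 x" if \<psi>: "pos_solution \<kappa> d c ?h \<psi>1" "pos_solution \<kappa> d c ?h \<psi>2" and x: "x \<in> {-d..d}"
    for \<psi>1 \<psi>2 x
  proof -
    let ?a = "\<kappa> * c - \<kappa> * d" and ?b = "\<kappa> * c + \<kappa> * d"
    obtain v1 v2 where n: "neumann_sol (?h / \<kappa>) ?a ?b (\<lambda>y. \<psi>1 (y / \<kappa> - c)) v1"
      "neumann_sol (?h / \<kappa>) ?a ?b (\<lambda>y. \<psi>2 (y / \<kappa> - c)) v2"
      using neumann_sol_of_pos_solution[OF _ pos(1)] \<psi> by blast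
    have a: "?a / \<kappa> - c = - d" using pos by (simp add: field_simps)
    have ode: "ode_sol (?h / \<kappa>) ?a ?b (\<lambda>y. \<psi>1 (y / \<kappa> - c)) v1" "v1 ?a = 0"
      "ode_sol (?h / \<kappa>) ?a ?b (\<lambda>y. \<psi>2 (y / \<kappa> - c)) v2" "v2 ?a = 0"
      using n by (simp_all add: neumann_sol_def)
    have "\<kappa> * (x + c) \<in> {?a..?b}"
      using x pos mult_left_mono[of "-d" x \<kappa>] mult_left_mono[of x d \<kappa>] by (auto simp: distrib_left)
    then have "\<psi>1 (\<kappa> * (x + c) / \<kappa> - c) = \<psi>2 (\<kappa> * (x + c) / \<kappa> - c)"
    proof (rule ode_unique(1)[OF ode(1,3), rotated 3])
      show "\<psi>1 (?a / \<kappa> - c) = \<psi>2 (?a / \<kappa> - c)"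
        using \<psi> unfolding a pos_solution_def by simp
      show "v1 ?a = v2 ?a" by (simp only: ode)
      show "0 \<le> ?h / \<kappa>" using h pos by simp
    qed
    then show ?thesis using pos by simp
  qed
  let ?\<psi> = "\<lambda>x. if x \<in> {-d..d} then \<psi> x else 0"
  have "psi0 \<kappa> d c = ?\<psi>"
    unfolding psi0_def
  proof (rule the_equality)
    have "pos_solution \<kappa> d c ?h ?\<psi>" by (rule pos_solution_cong[OF p]) (use pos in auto)
    then show "pos_solution \<kappa> d c ?h ?\<psi> \<and> (\<forall>x. x \<notin> {-d..d} \<longrightarrow> ?\<psi> x = 0)" by simp
    fix \<psi>' assume "pos_solution \<kappa> d c ?h \<psi>' \<and> (\<forall>x. x \<notin> {-d..d} \<longrightarrow> \<psi>' x = 0)"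
    then show "\<psi>' = ?\<psi>" using uniq[OF _ p] by (auto simp: fun_eq_iff)
  qed
  then show ?thesis using x by simp
qed

text \<open>The integrand is, up to a factor, the derivative of \<open>\<psi>'\<^sup>2 - \<kappa>\<^sup>2 (h\<^sup>2 (x + c)\<^sup>2 - 1) \<psi>\<^sup>2\<close>.\<close>

lemma integral_pos_solution:
  assumes p: "pos_solution \<kappa> d c h \<psi>" and pos: "\<kappa> > 0" "d > 0"
  shows "2 * h\<^sup>2 * integral {-d..d} (\<lambda>x. (x + c) * (\<psi> x)\<^sup>2)
    = (h\<^sup>2 * (d + c)\<^sup>2 - 1) * (\<psi> d)\<^sup>2 - (h\<^sup>2 * (c - d)\<^sup>2 - 1) * (\<psi> (-d))\<^sup>2"
proof -
  obtain \<phi> where \<psi>: "\<And>x. x \<in> {-d..d} \<Longrightarrow> (\<psi> has_real_derivative \<phi> x) (at x within {-d..d})"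
    and \<phi>: "\<And>x. x \<in> {-d..d} \<Longrightarrow> (\<phi> has_real_derivative \<kappa>\<^sup>2 * (h\<^sup>2 * (x + c)\<^sup>2 - 1) * \<psi> x)
        (at x within {-d..d})"
    and bc: "\<phi> (-d) = 0" "\<phi> d = 0"
    using p unfolding pos_solution_def by blast
  let ?H = "\<lambda>x. (h\<^sup>2 * (x + c)\<^sup>2 - 1) * (\<psi> x)\<^sup>2 - (\<phi> x)\<^sup>2 / \<kappa>\<^sup>2"
  have "((\<lambda>x. 2 * h\<^sup>2 * ((x + c) * (\<psi> x)\<^sup>2)) has_integral ?H d - ?H (-d)) {-d..d}"
  proof (rule fundamental_theorem_of_calculus)
    fix x assume x: "x \<in> {-d..d}"
    have 1: "((\<lambda>x. (h\<^sup>2 * (x + c)\<^sup>2 - 1) * (\<psi> x)\<^sup>2) has_real_derivative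
        2 * h\<^sup>2 * (x + c) * (\<psi> x)\<^sup>2 + (h\<^sup>2 * (x + c)\<^sup>2 - 1) * (2 * \<psi> x * \<phi> x)) (at x within {-d..d})"
      by (rule derivative_eq_intros \<psi>[OF x] refl)+ (simp add: algebra_simps)
    have 2: "((\<lambda>x. (\<phi> x)\<^sup>2 / \<kappa>\<^sup>2) has_real_derivative
        (2 * \<phi> x * (\<kappa>\<^sup>2 * (h\<^sup>2 * (x + c)\<^sup>2 - 1) * \<psi> x)) / \<kappa>\<^sup>2) (at x within {-d..d})"
    proof (rule DERIV_cdivide)
      show "((\<lambda>x. (\<phi> x)\<^sup>2) has_real_derivative
          2 * \<phi> x * (\<kappa>\<^sup>2 * (h\<^sup>2 * (x + c)\<^sup>2 - 1) * \<psi> x)) (at x within {-d..d})"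
        by (rule derivative_eq_intros \<phi>[OF x] refl)+ simp
    qed
    have eq: "2 * h\<^sup>2 * (x + c) * (\<psi> x)\<^sup>2 + (h\<^sup>2 * (x + c)\<^sup>2 - 1) * (2 * \<psi> x * \<phi> x)
        - (2 * \<phi> x * (\<kappa>\<^sup>2 * (h\<^sup>2 * (x + c)\<^sup>2 - 1) * \<psi> x)) / \<kappa>\<^sup>2 = 2 * h\<^sup>2 * ((x + c) * (\<psi> x)\<^sup>2)"
      using pos by simp
    show "(?H has_vector_derivative 2 * h\<^sup>2 * ((x + c) * (\<psi> x)\<^sup>2)) (at x within {-d..d})"
      using DERIV_diff[OF 1 2] unfolding eq
      by (simp only: has_real_derivative_iff_has_vector_derivative)
  qed (use pos in auto)
  from integral_unique[OF this] show ?thesis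
    using bc by (simp add: add.commute)
qed

text \<open>The endpoint formula of \<open>integral_pos_solution\<close>, after division by positive
  factors. The normalisation at the left end scales both endpoint terms alike, so any positive
  Neumann solution may be inserted.\<close>

lemma I_fun_zero_iff:
  assumes n: "neumann_sol g (\<kappa> * c - \<kappa> * d) (\<kappa> * c + \<kappa> * d) u v" and pos: "\<kappa> > 0" "d > 0" "g > 0"
  shows "I_fun \<kappa> d c = 0 \<longleftrightarrow> (g\<^sup>2 * (\<kappa> * c + \<kappa> * d)\<^sup>2 - 1) * (u (\<kappa> * c + \<kappa> * d))\<^sup>2
    = (g\<^sup>2 * (\<kappa> * c - \<kappa> * d)\<^sup>2 - 1) * (u (\<kappa> * c - \<kappa> * d))\<^sup>2"
proof -
  let ?a = "\<kappa> * c - \<kappa> * d" and ?b = "\<kappa> * c + \<kappa> * d"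
  let ?\<psi> = "\<lambda>x. 1 / u ?a * u (\<kappa> * x + \<kappa> * c)"
  note h = h_field_eq[OF n pos]
  have ua: "u ?a > 0" using n pos by (auto simp: neumann_sol_def)
  then have p: "pos_solution \<kappa> d c (h_field \<kappa> d c) ?\<psi>"
    using pos_solution_of_neumann_sol[OF neumann_sol_scale[OF n, of "1 / u ?a"] pos(1)] by (simp add: h)
  have "I_fun \<kappa> d c = integral {-d..d} (\<lambda>x. (x + c) * (?\<psi> x)\<^sup>2)"
    unfolding I_fun_def using psi0_eq[OF p _ pos(1,2)] h pos by (intro integral_cong) simp
  moreover have "2 * (\<kappa> * g)\<^sup>2 > 0" using pos by simp
  ultimately have "I_fun \<kappa> d c = 0 \<longleftrightarrow>
      ((\<kappa> * g)\<^sup>2 * (d + c)\<^sup>2 - 1) * (?\<psi> d)\<^sup>2 - ((\<kappa> * g)\<^sup>2 * (c - d)\<^sup>2 - 1) * (?\<psi> (-d))\<^sup>2 = 0"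
    using integral_pos_solution[OF p pos(1,2)] unfolding h by (metis mult_eq_0_iff less_irrefl)
  moreover have "\<kappa> * d + \<kappa> * c = ?b" "\<kappa> * - d + \<kappa> * c = ?a" by simp_all
  moreover have "(\<kappa> * g)\<^sup>2 * (d + c)\<^sup>2 = g\<^sup>2 * ?b\<^sup>2" "(\<kappa> * g)\<^sup>2 * (c - d)\<^sup>2 = g\<^sup>2 * ?a\<^sup>2"
    by (simp_all add: power2_eq_square algebra_simps)
  ultimately have "I_fun \<kappa> d c = 0 \<longleftrightarrow>
      (g\<^sup>2 * ?b\<^sup>2 - 1) * (1 / u ?a * u ?b)\<^sup>2 - (g\<^sup>2 * ?a\<^sup>2 - 1) * (1 / u ?a * u ?a)\<^sup>2 = 0"
    by (simp only:)
  then show ?thesis using ua by (simp add: power_divide field_simps)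
qed

text \<open>Reflection gives a solution for \<open>- c\<close> with the same \<open>g\<close> and
  exchanges the two endpoint terms.\<close>

lemma I_fun_minus_zero_iff:
  assumes n: "neumann_sol g (\<kappa> * c - \<kappa> * d) (\<kappa> * c + \<kappa> * d) u v" and pos: "\<kappa> > 0" "d > 0" "g > 0"
  shows "I_fun \<kappa> d (- c) = 0 \<longleftrightarrow> I_fun \<kappa> d c = 0"
proof -
  have n': "neumann_sol g (\<kappa> * (- c) - \<kappa> * d) (\<kappa> * (- c) + \<kappa> * d) (\<lambda>x. u (- x)) (\<lambda>x. - v (- x))"
    using neumann_sol_reflect[OF n] by simp
  have "- (\<kappa> * (- c) - \<kappa> * d) = \<kappa> * c + \<kappa> * d" "- (\<kappa> * (- c) + \<kappa> * d) = \<kappa> * c - \<kappa> * d"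
    by simp_all
  moreover from this have "(\<kappa> * (- c) - \<kappa> * d)\<^sup>2 = (\<kappa> * c + \<kappa> * d)\<^sup>2"
    "(\<kappa> * (- c) + \<kappa> * d)\<^sup>2 = (\<kappa> * c - \<kappa> * d)\<^sup>2"
    by (metis power2_minus)+
  ultimately show ?thesis
    unfolding I_fun_zero_iff[OF n pos] I_fun_zero_iff[OF n' pos] by (simp only:) (rule eq_commute)
qed

theorem theorem6:
  "\<exists>K>0. \<forall>\<kappa>>0. \<forall>d>0. \<kappa> * d > K \<longrightarrow>
     (\<exists>!c. c > 0 \<and> I_fun \<kappa> d c = 0) \<and>
     (\<exists>!c. c < 0 \<and> I_fun \<kappa> d c = 0) \<and>
     (\<forall>c\<^sub>1>0. I_fun \<kappa> d c\<^sub>1 = 0 \<longrightarrow> h_field \<kappa> d c\<^sub>1 > h_field \<kappa> d 0)"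
proof (rule exI[of _ threshold], intro conjI allI impI)
  fix \<kappa> d :: real
  assume \<kappa>: "\<kappa> > 0" and d: "d > 0" and K: "\<kappa> * d > threshold"
  let ?D = "\<kappa> * d"
  have D: "threshold \<le> ?D" "1 \<le> ?D" "0 < ?D" using K threshold_ge by simp_all
  have sol: "\<exists>g u v. 0 < g \<and> neumann_sol g (\<kappa> * c - ?D) (\<kappa> * c + ?D) u v" if "0 \<le> c" for c
    using neumann_sol_exists[of "\<kappa> * c" ?D] that \<kappa> D by simp
  have sym: "I_fun \<kappa> d (- c) = 0 \<longleftrightarrow> I_fun \<kappa> d c = 0" if "0 \<le> c" for c
    using sol[OF that] I_fun_minus_zero_iff[OF _ \<kappa> d] by blast
  \<comment> \<open>Every positive zero of \<open>I\<close> is the strict maximum of the field on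
    \<open>[0, d)\<close>; uniqueness and the comparison with \<open>c = 0\<close> both follow from
    this.\<close>
  have bound: "c < d" and less: "\<And>c'. 0 \<le> c' \<Longrightarrow> c' < d \<Longrightarrow> c' \<noteq> c \<Longrightarrow> h_field \<kappa> d c' < h_field \<kappa> d c"
    if c: "c > 0" "I_fun \<kappa> d c = 0" for c
  proof -
    obtain g u v where g: "0 < g" and n: "neumann_sol g (\<kappa> * c - ?D) (\<kappa> * c + ?D) u v"
      using sol[of c] c by auto
    have \<kappa>c: "0 < \<kappa> * c" using c \<kappa> by simp
    note crit = critical_neumann_sol[OF D(1) \<kappa>c g n I_fun_zero_iff[OF n \<kappa> d g, THEN iffD1, OF c(2)]]
    show "c < d" using crit(1) \<kappa> by simp
    fix c' assume c': "0 \<le> c'" "c' < d" "c' \<noteq> c"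
    obtain g' u' v' where g': "0 < g'" and n': "neumann_sol g' (\<kappa> * c' - ?D) (\<kappa> * c' + ?D) u' v'"
      using sol[OF c'(1)] by auto
    have "g' < g" using crit(2)[OF _ _ _ g' n'] c' \<kappa> by simp
    then show "h_field \<kappa> d c' < h_field \<kappa> d c"
      using h_field_eq[OF n \<kappa> d g] h_field_eq[OF n' \<kappa> d g'] \<kappa> by simp
  qed
  obtain c where c: "c > 0" "I_fun \<kappa> d c = 0"
  proof -
    obtain C g u v where C: "0 < C" "0 < g" "neumann_sol g (C - ?D) (C + ?D) u v"
      "(g\<^sup>2 * (C + ?D)\<^sup>2 - 1) * (u (C + ?D))\<^sup>2 = (g\<^sup>2 * (C - ?D)\<^sup>2 - 1) * (u (C - ?D))\<^sup>2"
      using ex_critical_neumann_sol[OF D(1)] by blast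
    have "\<kappa> * (C / \<kappa>) = C" using \<kappa> by simp
    then have "I_fun \<kappa> d (C / \<kappa>) = 0"
      using I_fun_zero_iff[of g \<kappa> "C / \<kappa>" d u v] C \<kappa> d by simp
    then show thesis using that[of "C / \<kappa>"] C \<kappa> by simp
  qed
  \<comment> \<open>Of two distinct positive zeros each would have a strictly larger field than the
    other.\<close>
  have uniq: "c' = c" if "c' > 0" "I_fun \<kappa> d c' = 0" for c'
    using less[OF c, of c'] less[OF that, of c] bound[OF c] bound[OF that] c(1) that(1) by force
  show "\<exists>!c. c > 0 \<and> I_fun \<kappa> d c = 0"
    using c uniq by blast
  show "\<exists>!c. c < 0 \<and> I_fun \<kappa> d c = 0"
  proof (rule ex1I[of _ "- c"])
    show "- c < 0 \<and> I_fun \<kappa> d (- c) = 0" using c sym[of c] by simp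
    fix c' assume "c' < 0 \<and> I_fun \<kappa> d c' = 0"
    then show "c' = - c" using uniq[of "- c'"] sym[of "- c'"] by simp
  qed
  show "h_field \<kappa> d 0 < h_field \<kappa> d c\<^sub>1" if "c\<^sub>1 > 0" "I_fun \<kappa> d c\<^sub>1 = 0" for c\<^sub>1
    using less[OF that, of 0] that d by simp
qed (use threshold_ge in linarith)

end
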